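(* Let $(f,\Gamma)$ be a pair as in the context, with $f$ concave in $\Gamma$ and $\frac{\partial f}{\partial\lambda_i}>0$ in $\Gamma$ for all $1\le i\le n$. Pick a positive constant $\varrho$ with $n-\varrho_{\Gamma_{\mathcal G}^f}\le\varrho<n$, and let $(\tilde f,\tilde\Gamma)$ be given by $$\tilde\Gamma:=P(\Gamma),\qquad \tilde f(P(\lambda)):=f(\lambda)\ (\lambda\in\Gamma),\qquad P(\lambda):=\sum_{j=1}^n\lambda_j\,\vec{\mathbf 1}-\varrho\lambda,$$ with $\varrho\le\varrho_{\tilde\Gamma_{\mathcal G}^{\tilde f}}$. Given a symmetric $(0,2)$-tensor $\chi$ on $\overline M$, denote $\tilde\chi:=(\mathrm{tr}_g\chi)\,g-\varrho\,\chi$. Then for any $C^2$-function $u$ with $\lambda[\nabla^2u+\chi]\in\Gamma$, $$f(\lambda[\nabla^2u+\chi])=\tilde f(\lambda[\Delta u\cdot g-\varrho\nabla^2u+\tilde\chi]).$$ Moreover, $(0,\ldots,0,1)\in\mathring\Gamma_{\mathcal G}^f$ if and only if $\varrho<\varrho_{\tilde\Gamma_{\mathcal G}^{\tilde f}}$.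
   Context: $(\overline M,g)$ is a compact connected Riemannian manifold of dimension $n\ge2$ with smooth boundary. $\nabla^2u$ and $\Delta u$ are the Hessian and Laplacian of $u$ with respect to the Levi-Civita connection of $g$, and $\lambda[A]$ is the $n$-tuple of eigenvalues, with respect to $g$, of a symmetric $(0,2)$-tensor $A$. $\vec{\mathbf 1}=(1,\ldots,1)\in\mathbb R^n$. A pair $(f,\Gamma)$ consists of an open symmetric (permutation invariant) convex cone $\Gamma\subset\mathbb R^n$ with vertex at the origin, $\partial\Gamma\ne\emptyset$, $\Gamma_n:=\{\lambda\in\mathbb R^n:\text{each }\lambda_i>0\}\subseteq\Gamma$, and a smooth symmetric function $f:\Gamma\to\mathbb R$. For $(h,K)=(f,\Gamma)$ or $(\tilde f,\tilde\Gamma)$ put $K_{\mathcal G}^h:=\{\lambda\in K:\lim_{s\to+\infty}h(s\lambda)>-\infty\}$, with interior $\mathring K_{\mathcal G}^h$ and boundary $\partial K_{\mathcal G}^h$, and define the constant $\varrho_{K_{\mathcal G}^h}$ by $(1,\ldots,1,1-\varrho_{K_{\mathcal G}^h})\in\partial K_{\mathcal G}^h$. The map $P$ is an invertible linear map since $0<\varrho<n$, so $\tilde f$ is well defined. *)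

theory Defs
  imports "HOL-Analysis.Analysis"
begin

section \<open>Functions of class \<open>C\<^sup>k\<close>\<close>

primrec Ck_open :: "nat \<Rightarrow> (real^'n) set \<Rightarrow> (real^'n \<Rightarrow> real) \<Rightarrow> bool" where
  "Ck_open 0 U F \<longleftrightarrow> continuous_on U F"
| "Ck_open (Suc k) U F \<longleftrightarrow> (\<forall>x\<in>U. F differentiable (at x)) \<and>
     (\<forall>i. Ck_open k U (\<lambda>x. frechet_derivative F (at x) (axis i 1)))"

text \<open>On a set that need not be open, e.g. a relatively open subset of a half space, a function is
  of class \<open>C\<^sup>k\<close> if near every point it has an extension of class \<open>C\<^sup>k\<close> to an open neighbourhood.
  Here \<open>k = \<infinity>\<close> means smooth: a single extension is of class \<open>C\<^sup>j\<close> for every \<open>j\<close>.\<close>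

definition Ck_on :: "enat \<Rightarrow> (real^'n) set \<Rightarrow> (real^'n \<Rightarrow> real) \<Rightarrow> bool" where
  "Ck_on k S F \<longleftrightarrow> (\<forall>x\<in>S. \<exists>U E. open U \<and> x \<in> U \<and> (\<forall>j. enat j \<le> k \<longrightarrow> Ck_open j U E) \<and>
     (\<forall>y\<in>S \<inter> U. E y = F y))"

section \<open>Riemannian manifolds with boundary\<close>

text \<open>A chart is a coordinate domain with a coordinate map; the values of the map outside the domain
  are irrelevant.  The finite linearly ordered index type \<open>'n\<close> plays the role of \<open>{1,\<dots>,n}\<close>, and
  \<open>Max UNIV\<close> is its last element \<open>n\<close>.\<close>

type_synonym ('m, 'n) chart = "'m set \<times> ('m \<Rightarrow> real^'n)"

abbreviation dom_of :: "('m, 'n::finite) chart \<Rightarrow> 'm set" where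
  "dom_of c \<equiv> fst c"

abbreviation coord_inv :: "('m, 'n::finite) chart \<Rightarrow> real^'n \<Rightarrow> 'm" where
  "coord_inv c \<equiv> inv_into (fst c) (snd c)"

definition half_space :: "(real^'n::{finite,linorder}) set" where
  "half_space = {x. 0 \<le> x $ Max UNIV}"

definition is_chart :: "'m topology \<Rightarrow> ('m, 'n::{finite,linorder}) chart \<Rightarrow> bool" where
  "is_chart X c \<longleftrightarrow> openin X (dom_of c) \<and>
     openin (top_of_set half_space) (snd c ` dom_of c) \<and>
     homeomorphic_map (subtopology X (dom_of c)) (top_of_set (snd c ` dom_of c)) (snd c)"

definition smooth_manifold_with_boundary ::
    "'m topology \<Rightarrow> ('m, 'n::{finite,linorder}) chart set \<Rightarrow> bool" where
  "smooth_manifold_with_boundary X \<A> \<longleftrightarrow>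
     Hausdorff_space X \<and> second_countable X \<and>
     (\<forall>c\<in>\<A>. is_chart X c) \<and> (\<Union>c\<in>\<A>. dom_of c) = topspace X \<and>
     (\<forall>c\<in>\<A>. \<forall>d\<in>\<A>. \<forall>i.
        Ck_on \<infinity> (snd c ` (dom_of c \<inter> dom_of d)) (\<lambda>x. snd d (coord_inv c x) $ i))"

definition Ck_function :: "enat \<Rightarrow> ('m, 'n::finite) chart set \<Rightarrow> ('m \<Rightarrow> real) \<Rightarrow> bool" where
  "Ck_function k \<A> u \<longleftrightarrow> (\<forall>c\<in>\<A>. Ck_on k (snd c ` dom_of c) (u \<circ> coord_inv c))"

text \<open>The \<open>i\<close>-th coordinate derivative, as a function on the manifold.  The derivative is taken
  within the image of the chart, so that it is one-sided at boundary points.\<close>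

definition cpartial :: "('m, 'n::finite) chart \<Rightarrow> 'n \<Rightarrow> ('m \<Rightarrow> real) \<Rightarrow> 'm \<Rightarrow> real" where
  "cpartial c i F p =
     frechet_derivative (F \<circ> coord_inv c) (at (snd c p) within snd c ` dom_of c) (axis i 1)"

text \<open>A \<open>(0,2)\<close>-tensor field is given by its component matrix in each chart, subject to the
  transformation law.\<close>

type_synonym ('m, 'n) tensor2 = "('m, 'n) chart \<Rightarrow> 'm \<Rightarrow> real^'n^'n"

definition transition_jacobian ::
    "('m, 'n::finite) chart \<Rightarrow> ('m, 'n) chart \<Rightarrow> 'm \<Rightarrow> real^'n^'n" where
  "transition_jacobian c d p =
     jacobian (snd d \<circ> coord_inv c) (at (snd c p) within snd c ` (dom_of c \<inter> dom_of d))"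

definition symmetric_tensor :: "('m, 'n::finite) chart set \<Rightarrow> ('m, 'n) tensor2 \<Rightarrow> bool" where
  "symmetric_tensor \<A> T \<longleftrightarrow>
     (\<forall>c\<in>\<A>. \<forall>p\<in>dom_of c. transpose (T c p) = T c p) \<and>
     (\<forall>c\<in>\<A>. \<forall>d\<in>\<A>. \<forall>p\<in>dom_of c \<inter> dom_of d.
        T c p = transpose (transition_jacobian c d p) ** T d p ** transition_jacobian c d p)"

definition riemannian_metric :: "('m, 'n::finite) chart set \<Rightarrow> ('m, 'n) tensor2 \<Rightarrow> bool" where
  "riemannian_metric \<A> g \<longleftrightarrow> symmetric_tensor \<A> g \<and>
     (\<forall>c\<in>\<A>. \<forall>p\<in>dom_of c. \<forall>v. v \<noteq> 0 \<longrightarrow> 0 < v \<bullet> (g c p *v v)) \<and>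
     (\<forall>c\<in>\<A>. \<forall>i j. Ck_on \<infinity> (snd c ` dom_of c) (\<lambda>x. g c (coord_inv c x) $ i $ j))"

text \<open>The coefficient \<open>\<Gamma>\<^sup>k\<^sub>i\<^sub>j\<close> of the Levi-Civita connection.\<close>

definition christoffel :: "('m, 'n::finite) tensor2 \<Rightarrow> ('m, 'n) chart \<Rightarrow> 'n \<Rightarrow> 'n \<Rightarrow> 'n \<Rightarrow> 'm \<Rightarrow> real" where
  "christoffel g c k i j p = (\<Sum>l\<in>UNIV. matrix_inv (g c p) $ k $ l *
     (cpartial c i (\<lambda>q. g c q $ j $ l) p + cpartial c j (\<lambda>q. g c q $ i $ l) p
      - cpartial c l (\<lambda>q. g c q $ i $ j) p)) / 2"

definition hessian :: "('m, 'n::finite) tensor2 \<Rightarrow> ('m \<Rightarrow> real) \<Rightarrow> ('m, 'n) tensor2" where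
  "hessian g u c p = (\<chi> i j. cpartial c i (cpartial c j u) p
     - (\<Sum>k\<in>UNIV. christoffel g c k i j p * cpartial c k u p))"

definition trace_g :: "('m, 'n::finite) tensor2 \<Rightarrow> ('m, 'n) tensor2 \<Rightarrow> ('m, 'n) chart \<Rightarrow> 'm \<Rightarrow> real" where
  "trace_g g T c p = trace (matrix_inv (g c p) ** T c p)"

definition laplacian :: "('m, 'n::finite) tensor2 \<Rightarrow> ('m \<Rightarrow> real) \<Rightarrow> ('m, 'n) chart \<Rightarrow> 'm \<Rightarrow> real" where
  "laplacian g u = trace_g g (hessian g u)"

text \<open>The eigenvalues of \<open>T\<close> with respect to \<open>g\<close> are those of the endomorphism \<open>g\<^sup>-\<^sup>1T\<close>, i.e. the
  roots of its characteristic polynomial with multiplicity.  They are determined up to order, and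
  the choice of the order is immaterial because the tuple is only inserted into symmetric functions
  and tested for membership in symmetric sets.\<close>

definition eigenvalue_tuple :: "real^'n^'n \<Rightarrow> real^'n^'n \<Rightarrow> real^'n \<Rightarrow> bool" where
  "eigenvalue_tuple G T l \<longleftrightarrow>
     (\<forall>t. det (matrix_inv G ** T - mat t) = (\<Prod>i\<in>UNIV. l $ i - t))"

definition eigenvalues ::
    "('m, 'n::finite) tensor2 \<Rightarrow> ('m, 'n) tensor2 \<Rightarrow> ('m, 'n) chart \<Rightarrow> 'm \<Rightarrow> real^'n" where
  "eigenvalues g T c p = (SOME l. eigenvalue_tuple (g c p) (T c p) l)"

section \<open>Cones and symmetric functions\<close>

definition positive_cone :: "(real^'n) set" where
  "positive_cone = {l. \<forall>i. 0 < l $ i}"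

text \<open>The predicate \<open>cone\<close> of the library is not used, since it would force an open cone to be the
  whole space: it requires nonempty cones to contain the vertex.\<close>

definition admissible_cone :: "(real^'n) set \<Rightarrow> bool" where
  "admissible_cone K \<longleftrightarrow> open K \<and> convex K \<and> (\<forall>l\<in>K. \<forall>t>0. t *\<^sub>R l \<in> K) \<and>
     (\<forall>\<pi>. \<pi> permutes UNIV \<longrightarrow> (\<forall>l\<in>K. (\<chi> i. l $ \<pi> i) \<in> K)) \<and>
     frontier K \<noteq> {} \<and> positive_cone \<subseteq> K"

definition admissible_pair :: "(real^'n \<Rightarrow> real) \<Rightarrow> (real^'n) set \<Rightarrow> bool" where
  "admissible_pair h K \<longleftrightarrow> admissible_cone K \<and> Ck_on \<infinity> K h \<and>
     (\<forall>\<pi>. \<pi> permutes UNIV \<longrightarrow> (\<forall>l\<in>K. h (\<chi> i. l $ \<pi> i) = h l))"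

definition cone_G :: "(real^'n \<Rightarrow> real) \<Rightarrow> (real^'n) set \<Rightarrow> (real^'n) set" where
  "cone_G h K = {l \<in> K. \<exists>L::ereal. ((\<lambda>s. ereal (h (s *\<^sub>R l))) \<longlongrightarrow> L) at_top \<and> L > -\<infinity>}"

definition rho_G ::
    "(real^'n::{finite,linorder} \<Rightarrow> real) \<Rightarrow> (real^'n::{finite,linorder}) set \<Rightarrow> real" where
  "rho_G h K =
     (THE r. (\<chi> i. if i = Max UNIV then 1 - r else 1) \<in> frontier (cone_G h K))"

definition P_map :: "real \<Rightarrow> real^'n \<Rightarrow> real^'n" where
  "P_map \<rho> l = (\<Sum>j\<in>UNIV. l $ j) *\<^sub>R (\<chi> i. 1) - \<rho> *\<^sub>R l"

end

theory Submission
  imports Defs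
begin

text \<open>
  The proposition has a pointwise algebraic half and a half about convex cones.

  The eigenvalue identity holds because \<open>A = g\<^sup>-\<^sup>1(\<nabla>\<^sup>2u + \<chi>)\<close> is diagonalizable over the reals:
  the tensor \<open>\<Delta>u g - \<rho>\<nabla>\<^sup>2u + \<chi>'\<close> corresponds to \<open>tr(A) I - \<rho> A\<close>, which has the same eigenvectors
  and the eigenvalues \<open>P(\<lambda>)\<close> if \<open>A\<close> has the eigenvalues \<open>\<lambda>\<close>.  Real diagonalizability comes from
  maximizing Rayleigh quotients (\<open>exists_orthogonal_eigenvector\<close>) and needs the Hessian to be a
  symmetric matrix.  As \<open>u\<close> is only \<open>C\<^sup>2\<close> up to the boundary, that is Schwarz's theorem for a local
  \<open>C\<^sup>2\<close> extension, whose derivatives the one-sided coordinate derivatives determine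
  (\<open>second_cpartial_commute\<close>).  The tuples of eigenvalues being chosen in an arbitrary order, the
  identity is first obtained up to a permutation; \<open>f\<close> and \<open>\<Gamma>\<close> are symmetric.

  For the cones, write \<open>C\<close> for the set where \<open>f\<close> has a limit above \<open>-\<infinity>\<close> along rays, and \<open>C'\<close> for its
  analogue for \<open>f'\<close>.  A concave function on a half line tends to \<open>-\<infinity>\<close> unless it is bounded below,
  so \<open>C\<close> is a convex cone (\<open>convex_cone_G\<close>); it contains the positive cone since \<open>f\<close> is increasing.
  Clearly \<open>C' = P(C)\<close>.  The line \<open>r \<mapsto> (1,\<dots>,1,1 - r)\<close> leaves such a convex set at exactly one
  parameter, which is the number \<open>rho_G\<close> (\<open>ray_interior_cone_G_iff\<close>).  Everything is then read off
  by pulling the line back under \<open>P\<close>.  At \<open>r = \<rho>\<close> its preimage is exactly \<open>(0,\<dots>,0,1)\<close>, which is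
  the claimed equivalence; for \<open>0 \<le> r < \<rho>\<close> the preimage is positive, so the line cannot have left
  \<open>C'\<close> before \<open>\<rho>\<close>.  The bound \<open>n - rho_G f \<Gamma> \<le> \<rho>\<close> enters for \<open>r \<le> 0\<close>: there the preimage is a
  positive multiple of \<open>(1,\<dots>,1,1 - t)\<close> with \<open>t < n - \<rho>\<close>.  It excludes a second
  point of the line on the frontier of \<open>C'\<close>, at a negative parameter, and so makes \<open>rho_G f' \<Gamma>'\<close>
  well defined.
\<close>

section \<open>The exit parameter of a convex set\<close>

text \<open>The points whose parameter on the frontier of the cone defines \<open>rho_G\<close>.\<close>

definition ray :: "real \<Rightarrow> real^'n::{finite,linorder}" where
  "ray r = (\<chi> i. if i = Max UNIV then 1 - r else 1)"

lemma ray_nth: "ray r $ i = (if i = Max UNIV then 1 - r else 1)"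
  by (simp add: ray_def)

text \<open>By convexity, all points strictly between the interior point \<open>ray 0\<close> and a point \<open>ray r\<close> of the
  closure are interior.  Hence the interior parameters form an open half line, and beyond its end
  point \<open>R\<close> there are no points of the closure.\<close>

lemma convex_ray_exit:
  fixes C :: "(real^'n::{finite,linorder}) set"
  assumes C: "convex C" and inside: "\<And>r. r \<le> 0 \<Longrightarrow> ray r \<in> interior C"
    and outside: "ray s \<notin> interior C"
  obtains R where "\<And>r. ray r \<in> frontier C \<longleftrightarrow> r = R" "\<And>r. ray r \<in> interior C \<longleftrightarrow> r < R"
proof -
  define I where "I = {r. ray r \<in> interior C}"
  have ray: "ray r = (\<chi> i. 1) - r *\<^sub>R (axis (Max UNIV) 1 :: real^'n::{finite,linorder})" for r
    by (simp add: vec_eq_iff axis_def ray_nth)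
  have cont: "continuous_on UNIV (ray :: real \<Rightarrow> real^'n::{finite,linorder})"
    unfolding ray by (intro continuous_intros)
  have "I = ray -` interior C" by (auto simp: I_def)
  hence "open I" using open_vimage[OF open_interior cont] by simp
  have between: "ray q \<in> interior C" if "0 < q" "q < r" "ray r \<in> closure C" for q r
  proof -
    have "(1 - q / r) *\<^sub>R ray 0 + (q / r) *\<^sub>R ray r = (ray q :: real^'n::{finite,linorder})"
      using that by (simp add: ray algebra_simps)
    hence "(ray q :: real^'n::{finite,linorder}) \<in> open_segment (ray 0) (ray r)"
      using that unfolding in_segment
      by (intro conjI exI[of _ "q / r"]) (auto simp: ray axis_eq_0_iff)
    thus ?thesis
      using in_interior_closure_convex_segment[OF C inside[OF order_refl] that(3)] by blast
  qed
  have down: "q \<in> I" if "r \<in> I" "q \<le> r" for q r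
    using that inside[of q] between[of q r] closure_subset interior_subset
    by (cases "q \<le> 0"; cases "q = r") (auto simp: I_def)
  have bdd: "r \<le> s" if "r \<in> I" for r using down[OF that, of s] outside by (force simp: I_def)
  define R where "R = Sup I"
  have "0 \<in> I" using inside by (simp add: I_def)
  have bddI: "bdd_above I" using bdd by (auto simp: bdd_above_def)
  have le: "r \<le> R" if "r \<in> I" for r using cSup_upper[OF that bddI] by (simp add: R_def)
  have R_notin: "R \<notin> I"
  proof
    assume "R \<in> I"
    then obtain e where e: "0 < e" "ball R e \<subseteq> I"
      using \<open>open I\<close> open_contains_ball by blast
    moreover have "R + e / 2 \<in> ball R e" using e by (simp add: dist_norm)
    ultimately have "R + e / 2 \<le> R" by (intro le) blast
    thus False using e by simp
  qed
  have int: "ray r \<in> interior C \<longleftrightarrow> r < R" for r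
  proof
    assume "ray r \<in> interior C"
    hence "r \<in> I" by (simp add: I_def)
    thus "r < R" using le R_notin by (metis order_le_less)
  next
    assume "r < R"
    then obtain q where "q \<in> I" "r < q"
      using less_cSup_iff[of I r] \<open>0 \<in> I\<close> bddI by (auto simp: R_def)
    thus "ray r \<in> interior C" using down[of q r] by (simp add: I_def)
  qed
  have R_closure: "ray R \<in> closure C"
  proof -
    have "((ray :: real \<Rightarrow> real^'n::{finite,linorder}) \<longlongrightarrow> ray R) (at_left R)"
      using cont by (meson UNIV_I at_le continuous_on_def subset_UNIV tendsto_mono)
    moreover have "\<forall>\<^sub>F r in at_left R. ray r \<in> C"
    proof -
      have "R - 1 < R" by simp
      from eventually_at_left_real[OF this] show ?thesis
        using int interior_subset by (auto elim!: eventually_mono)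
    qed
    ultimately show ?thesis
      by (intro Lim_in_closed_set[OF closed_closure])
        (auto elim!: eventually_mono intro: closure_subset[THEN subsetD])
  qed
  have "ray r \<in> frontier C \<longleftrightarrow> r = R" for r
  proof
    assume r: "ray r \<in> frontier C"
    hence "\<not> r < R" using int by (simp add: frontier_def)
    moreover have "\<not> R < r"
    proof
      assume "R < r"
      moreover have "0 < R" using int[of 0] inside[of 0] by simp
      ultimately have "ray R \<in> interior C" using between r by (simp add: frontier_def)
      thus False using int by simp
    qed
    ultimately show "r = R" by simp
  next
    assume "r = R"
    thus "ray r \<in> frontier C" using R_closure int by (simp add: frontier_def)
  qed
  thus ?thesis using that int by blast
qed

text \<open>Here the description operator in \<open>rho_G\<close> is discharged once and for all.\<close>

lemma ray_interior_cone_G_iff: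
  fixes h :: "real^'n::{finite,linorder} \<Rightarrow> real"
  assumes "convex (cone_G h K)" and "\<And>r. r \<le> 0 \<Longrightarrow> ray r \<in> interior (cone_G h K)"
    and "ray s \<notin> interior (cone_G h K)"
  shows "ray r \<in> interior (cone_G h K) \<longleftrightarrow> r < rho_G h K"
proof -
  obtain R where R: "\<And>r. ray r \<in> frontier (cone_G h K) \<longleftrightarrow> r = R"
    "\<And>r. ray r \<in> interior (cone_G h K) \<longleftrightarrow> r < R"
    using convex_ray_exit[OF assms] by metis
  have "rho_G h K = R" unfolding rho_G_def ray_def[symmetric] R(1) by simp
  thus ?thesis using R(2) by simp
qed

section \<open>The cone of rays with limit above minus infinity\<close>

lemma concave_three_points:
  fixes \<phi> :: "real \<Rightarrow> real"
  assumes \<phi>: "concave_on {0<..} \<phi>" and "0 < a" "a < b" "b < s"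
  shows "(s - b) * \<phi> a + (b - a) * \<phi> s \<le> (s - a) * \<phi> b"
proof -
  let ?t = "(b - a) / (s - a)"
  have t: "0 \<le> ?t" "?t \<le> 1" "(s - a) * ?t = b - a"
    using assms by simp_all
  have t': "(s - a) * (1 - ?t) = s - b" using t(3) by (simp add: right_diff_distrib)
  have conv: "(1 - ?t) * a + ?t * s = b"
  proof -
    have "(1 - ?t) * a + ?t * s = a + (s - a) * ?t" by (simp only: algebra_simps)
    thus ?thesis using t(3) by simp
  qed
  have "(1 - ?t) * \<phi> a + ?t * \<phi> s \<le> \<phi> ((1 - ?t) *\<^sub>R a + ?t *\<^sub>R s)"
    using assms t(1,2) by (intro concave_onD[OF \<phi>]) auto
  hence "(1 - ?t) * \<phi> a + ?t * \<phi> s \<le> \<phi> b" using conv by simp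
  hence "(s - a) * ((1 - ?t) * \<phi> a + ?t * \<phi> s) \<le> (s - a) * \<phi> b"
    using assms by (intro mult_left_mono) auto
  also have "(s - a) * ((1 - ?t) * \<phi> a + ?t * \<phi> s) = (s - b) * \<phi> a + (b - a) * \<phi> s"
    using t(3) t' by (simp only: distrib_left mult.assoc[symmetric])
  finally show ?thesis .
qed

text \<open>Beyond \<open>b\<close> the graph lies below the secant through \<open>a\<close> and \<open>b\<close>, which has the slope \<open>-\<delta> < 0\<close>.\<close>

lemma concave_decreasing_imp_at_bot:
  fixes \<phi> :: "real \<Rightarrow> real"
  assumes \<phi>: "concave_on {0<..} \<phi>" and ab: "0 < a" "a < b" "\<phi> b < \<phi> a"
  shows "\<forall>\<^sub>F s in at_top. \<phi> s < B"
proof -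
  define \<delta> where "\<delta> = (\<phi> a - \<phi> b) / (b - a)"
  have \<delta>: "0 < \<delta>" "\<phi> a = \<phi> b + (b - a) * \<delta>" using ab by (simp_all add: \<delta>_def)
  have "\<phi> s < B" if s: "s > max b (b + (\<phi> b - B) / \<delta>)" for s
  proof -
    have "(s - b) * (\<phi> b + (b - a) * \<delta>) + (b - a) * \<phi> s \<le> (s - a) * \<phi> b"
      using concave_three_points[OF \<phi> ab(1,2), of s] s \<delta>(2) by simp
    hence "(b - a) * (\<phi> s + (s - b) * \<delta>) \<le> (b - a) * \<phi> b" by (simp add: algebra_simps)
    hence "\<phi> s + (s - b) * \<delta> \<le> \<phi> b" using ab by simp
    moreover have "\<phi> b - B < (s - b) * \<delta>" using s \<delta>(1) by (simp add: field_simps)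
    ultimately show ?thesis by linarith
  qed
  thus ?thesis unfolding eventually_at_top_dense by blast
qed

text \<open>Along a ray in \<open>K\<close> a concave function either decreases somewhere, and then tends to \<open>-\<infinity>\<close>, or is
  nondecreasing, and then has a limit.  Boundedness below on \<open>s \<ge> 1\<close> separates the two cases and,
  unlike the existence of a limit, visibly passes to convex combinations.\<close>

lemma cone_G_iff_bounded_below:
  fixes f :: "real^'n \<Rightarrow> real"
  assumes f: "concave_on K f" and K: "\<And>l t. l \<in> K \<Longrightarrow> 0 < t \<Longrightarrow> t *\<^sub>R l \<in> K"
    and l: "l \<in> K"
  shows "l \<in> cone_G f K \<longleftrightarrow> (\<exists>B. \<forall>s\<ge>1. B \<le> f (s *\<^sub>R l))"
proof -
  define \<phi> where "\<phi> s = f (s *\<^sub>R l)" for s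
  have \<phi>: "concave_on {0<..} \<phi>"
  proof -
    have "\<phi> ((1 - t) *\<^sub>R x + t *\<^sub>R y) \<ge> (1 - t) * \<phi> x + t * \<phi> y"
      if "0 < t" "t < 1" "0 < x" "0 < y" for t x y
      using concave_onD[OF f, of t "x *\<^sub>R l" "y *\<^sub>R l"] that K[OF l]
      by (simp add: \<phi>_def scaleR_add_left)
    thus ?thesis unfolding concave_on_def by (intro convex_onI) (force simp: convex_real_interval)+
  qed
  have mono: "\<phi> a \<le> \<phi> b" if "\<not> (\<forall>B. \<forall>\<^sub>F s in at_top. \<phi> s < B)" "0 < a" "a \<le> b" for a b
    using concave_decreasing_imp_at_bot[OF \<phi>, of a b] that by (cases "a = b") force+
  show ?thesis
  proof
    assume "l \<in> cone_G f K"
    then obtain L where L: "((\<lambda>s. ereal (\<phi> s)) \<longlongrightarrow> L) at_top" "L > -\<infinity>"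
      by (auto simp: cone_G_def \<phi>_def)
    have "\<not> (\<forall>B. \<forall>\<^sub>F s in at_top. \<phi> s < B)"
    proof
      assume *: "\<forall>B. \<forall>\<^sub>F s in at_top. \<phi> s < B"
      have "L \<le> ereal B" for B
        using * by (intro tendsto_upperbound[OF L(1)]) (auto elim!: eventually_mono intro: less_imp_le)
      hence "L = -\<infinity>" by (metis ereal_bot)
      thus False using L(2) by simp
    qed
    from mono[OF this, of 1] show "\<exists>B. \<forall>s\<ge>1. B \<le> f (s *\<^sub>R l)" by (auto simp: \<phi>_def)
  next
    assume "\<exists>B. \<forall>s\<ge>1. B \<le> f (s *\<^sub>R l)"
    then obtain B where B: "\<And>s. s \<ge> 1 \<Longrightarrow> B \<le> \<phi> s" by (auto simp: \<phi>_def)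
    have "\<not> (\<forall>\<^sub>F s in at_top. \<phi> s < B)"
    proof
      assume "\<forall>\<^sub>F s in at_top. \<phi> s < B"
      then obtain s0 where "\<And>s. s \<ge> s0 \<Longrightarrow> \<phi> s < B" by (auto simp: eventually_at_top_linorder)
      from this[of "max s0 1"] B[of "max s0 1"] show False by simp
    qed
    hence mono: "\<phi> a \<le> \<phi> b" if "0 < a" "a \<le> b" for a b using mono that by blast
    define L where "L = (SUP s\<in>{0<..}. ereal (\<phi> s))"
    have le: "ereal (\<phi> s) \<le> L" if "0 < s" for s
      using that unfolding L_def by (intro SUP_upper) auto
    have "((\<lambda>s. ereal (\<phi> s)) \<longlongrightarrow> L) at_top"
    proof (rule increasing_tendsto)
      show "\<forall>\<^sub>F s in at_top. ereal (\<phi> s) \<le> L"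
        using eventually_gt_at_top[of "0::real"] by eventually_elim (rule le)
      fix x assume "x < L"
      then obtain s0 where s0: "0 < s0" "x < ereal (\<phi> s0)"
        unfolding L_def less_SUP_iff by auto
      have "x < ereal (\<phi> s)" if "s0 \<le> s" for s
        using s0 mono[OF s0(1) that] by (metis ereal_less_eq(3) less_le_trans)
      thus "\<forall>\<^sub>F s in at_top. x < ereal (\<phi> s)" unfolding eventually_at_top_linorder by blast
    qed
    moreover have "L > -\<infinity>" using le[of 1] by (metis MInfty_neq_ereal(1) ereal_infty_less_eq(2)
      ereal_less_eq(2) not_less zero_less_one)
    ultimately show "l \<in> cone_G f K" using l by (auto simp: cone_G_def \<phi>_def)
  qed
qed

lemma convex_cone_G:
  fixes f :: "real^'n \<Rightarrow> real"
  assumes f: "concave_on K f" and K: "\<And>l t. l \<in> K \<Longrightarrow> 0 < t \<Longrightarrow> t *\<^sub>R l \<in> K"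
  shows "convex (cone_G f K)"
proof (rule convexI)
  fix x y :: "real^'n" and u v :: real
  assume x: "x \<in> cone_G f K" and y: "y \<in> cone_G f K" and uv: "0 \<le> u" "0 \<le> v" "u + v = 1"
  have xy: "x \<in> K" "y \<in> K" using x y by (auto simp: cone_G_def)
  obtain B C where B: "\<And>s. s \<ge> 1 \<Longrightarrow> B \<le> f (s *\<^sub>R x)" and C: "\<And>s. s \<ge> 1 \<Longrightarrow> C \<le> f (s *\<^sub>R y)"
    using cone_G_iff_bounded_below[OF f K xy(1)] cone_G_iff_bounded_below[OF f K xy(2)] x y by auto
  have "convex K" using f by (simp add: concave_on_imp_convex)
  hence mem: "u *\<^sub>R x + v *\<^sub>R y \<in> K" using xy uv by (simp add: convexD)
  have "u * B + v * C \<le> f (s *\<^sub>R (u *\<^sub>R x + v *\<^sub>R y))" if s: "s \<ge> 1" for s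
  proof -
    have "u * B + v * C \<le> u * f (s *\<^sub>R x) + v * f (s *\<^sub>R y)"
      using uv B[OF s] C[OF s] by (intro add_mono mult_left_mono) auto
    also have "\<dots> \<le> f (u *\<^sub>R (s *\<^sub>R x) + v *\<^sub>R (s *\<^sub>R y))"
      using concave_onD[OF f, of v "s *\<^sub>R x" "s *\<^sub>R y"] uv s K xy
      by (simp add: eq_diff_eq[symmetric] add.commute)
    finally show ?thesis by (simp add: scaleR_add_right mult.commute)
  qed
  thus "u *\<^sub>R x + v *\<^sub>R y \<in> cone_G f K" using cone_G_iff_bounded_below[OF f K mem] by blast
qed

lemma cone_G_scaleR:
  assumes K: "\<And>l t. l \<in> K \<Longrightarrow> 0 < t \<Longrightarrow> t *\<^sub>R l \<in> K" and l: "l \<in> cone_G f K" and t: "0 < t"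
  shows "t *\<^sub>R l \<in> cone_G f K"
proof -
  obtain L where L: "((\<lambda>s. ereal (f (s *\<^sub>R l))) \<longlongrightarrow> L) at_top" "L > -\<infinity>"
    using l by (auto simp: cone_G_def)
  have "filterlim (\<lambda>s. s * t) at_top at_top"
    using t by (simp add: filterlim_at_top_mult_tendsto_pos[OF tendsto_const] filterlim_ident
      filterlim_tendsto_pos_mult_at_top mult.commute)
  from filterlim_compose[OF L(1) this] show ?thesis
    using L(2) l t K by (auto simp: cone_G_def)
qed

lemma interior_cone_G_scaleR:
  assumes K: "\<And>l t. l \<in> K \<Longrightarrow> 0 < t \<Longrightarrow> t *\<^sub>R l \<in> K" and l: "l \<in> interior (cone_G f K)" and t: "0 < t"
  shows "t *\<^sub>R l \<in> interior (cone_G f K)"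
proof -
  have "t *\<^sub>R l \<in> (*\<^sub>R) t ` interior (cone_G f K)" using l by (rule imageI)
  moreover have "open ((*\<^sub>R) t ` interior (cone_G f K))"
    using t by (intro open_scaling) auto
  moreover have "(*\<^sub>R) t ` interior (cone_G f K) \<subseteq> cone_G f K"
    using cone_G_scaleR[OF K] t interior_subset by blast
  ultimately show ?thesis using interior_maximal by blast
qed

lemma Ck_on_has_derivative:
  assumes "Ck_on k S F" and "1 \<le> k" and "open S" "x \<in> S"
  shows "(F has_derivative frechet_derivative F (at x)) (at x)"
proof -
  obtain U E where U: "open U" "x \<in> U" "\<And>j. enat j \<le> k \<Longrightarrow> Ck_open j U E"
    and E: "\<And>y. y \<in> S \<inter> U \<Longrightarrow> E y = F y"
    using assms(1,4) unfolding Ck_on_def by metis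
  have "Ck_open (Suc 0) U E" using U(3)[of "Suc 0"] assms(2) by (simp add: one_enat_def)
  hence "E differentiable (at x)" using U(2) by simp
  then obtain D where D: "(E has_derivative D) (at x)" by (auto simp: differentiable_def)
  have "(F has_derivative D) (at x)"
    by (rule has_derivative_transform_within_open[OF D, of "S \<inter> U"]) (use assms U E in auto)
  thus ?thesis using frechet_derivative_at by blast
qed

text \<open>In a direction with positive entries, the radial derivative is a positive combination of the
  partial derivatives, so \<open>f\<close> is nondecreasing along the ray.\<close>

lemma positive_cone_subset_cone_G:
  fixes f :: "real^'n \<Rightarrow> real"
  assumes f: "concave_on K f" and K: "\<And>l t. l \<in> K \<Longrightarrow> 0 < t \<Longrightarrow> t *\<^sub>R l \<in> K"
    and pos: "positive_cone \<subseteq> K"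
    and diff: "\<And>l. l \<in> K \<Longrightarrow> (f has_derivative frechet_derivative f (at l)) (at l)"
    and mono: "\<And>l i. l \<in> K \<Longrightarrow> 0 < frechet_derivative f (at l) (axis i 1)"
  shows "positive_cone \<subseteq> cone_G f K"
proof
  fix l :: "real^'n" assume l: "l \<in> positive_cone"
  hence lK: "l \<in> K" using pos by blast
  have "f (1 *\<^sub>R l) \<le> f (s *\<^sub>R l)" if "1 \<le> s" for s
  proof (rule DERIV_nonneg_imp_nondecreasing[OF that])
    fix x :: real assume x: "1 \<le> x" "x \<le> s"
    let ?D = "frechet_derivative f (at (x *\<^sub>R l))"
    have xl: "x *\<^sub>R l \<in> K" using K[OF lK] x by simp
    have lin: "linear ?D" using diff[OF xl] has_derivative_linear by blast
    have "((\<lambda>x. x *\<^sub>R l) has_derivative (\<lambda>t. t *\<^sub>R l)) (at x)"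
      by (auto intro!: derivative_eq_intros)
    from has_derivative_compose[OF this diff[OF xl]]
    have "((\<lambda>x. f (x *\<^sub>R l)) has_real_derivative ?D l) (at x)"
      using lin by (simp add: has_field_derivative_def linear_cmul mult.commute[of _ "?D _"])
    moreover have "?D l \<ge> 0"
    proof -
      have "?D l = ?D (\<Sum>i\<in>UNIV. l $ i *\<^sub>R axis i 1)"
        by (subst basis_expansion[of l, symmetric]) (simp add: scalar_mult_eq_scaleR)
      also have "\<dots> = (\<Sum>i\<in>UNIV. l $ i * ?D (axis i 1))"
        using lin by (simp add: linear_sum linear_cmul)
      also have "\<dots> \<ge> 0"
        using l mono[OF xl] by (intro sum_nonneg) (simp add: positive_cone_def less_imp_le)
      finally show ?thesis .
    qed
    ultimately show "\<exists>y. ((\<lambda>s. f (s *\<^sub>R l)) has_real_derivative y) (at x) \<and> 0 \<le> y" by blast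
  qed
  thus "l \<in> cone_G f K" using cone_G_iff_bounded_below[OF f K lK] by blast
qed

lemma open_positive_cone: "open (positive_cone :: (real^'n) set)"
proof -
  have eq: "positive_cone = (\<Inter>i. {l :: real^'n. 0 < l $ i})" by (auto simp: positive_cone_def)
  show ?thesis unfolding eq
    by (intro open_INT finite ballI open_Collect_less continuous_intros)
qed

text \<open>An open cone around the vertex is the whole space, which has no frontier.\<close>

lemma admissible_cone_zero_notin:
  assumes "admissible_cone K"
  shows "0 \<notin> K"
proof
  assume "0 \<in> K"
  then obtain e where e: "0 < e" "ball 0 e \<subseteq> K"
    using assms unfolding admissible_cone_def by (meson open_contains_ball)
  have "x \<in> K" for x
  proof -
    define t where "t = (norm x + 1) / e"
    have t: "0 < t" using e by (simp add: t_def add_nonneg_pos)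
    have "norm (x /\<^sub>R t) < e"
    proof -
      have "norm x < e * t" using e by (simp add: t_def)
      hence "norm x / t < e" using t by (simp add: pos_divide_less_eq)
      thus ?thesis using t by (simp add: divide_inverse_commute)
    qed
    hence "x /\<^sub>R t \<in> K" using e by auto
    hence "t *\<^sub>R (x /\<^sub>R t) \<in> K" using assms t unfolding admissible_cone_def by blast
    thus ?thesis using t by simp
  qed
  hence "K = UNIV" by blast
  thus False using assms by (simp add: admissible_cone_def)
qed

text \<open>The \<open>n\<close> permutations of such a point, one for each position of the exceptional entry, have the
  barycentre \<open>0\<close>.  Together with the case of a negative factor, this bounds the parameters of the
  points \<open>ray r\<close> both in the cone and, after applying the inverse of \<open>P\<close>, in its image.\<close>

lemma admissible_cone_trace_free_notin:
  fixes K :: "(real^'n) set"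
  assumes K: "admissible_cone K"
  shows "c *\<^sub>R ((\<chi> i. 1) - real CARD('n) *\<^sub>R axis k 1) \<notin> K"
proof
  let ?l = "\<lambda>k. c *\<^sub>R ((\<chi> i. 1) - real CARD('n) *\<^sub>R axis k 1) :: real^'n"
  assume l: "?l k \<in> K"
  have "?l j \<in> K" for j
  proof -
    have "?l j = (\<chi> i. ?l k $ Transposition.transpose j k i)"
      by (auto simp: vec_eq_iff axis_def Transposition.transpose_def)
    moreover have "Transposition.transpose j k permutes UNIV" by (simp add: permutes_swap_id)
    ultimately show ?thesis using K l unfolding admissible_cone_def by metis
  qed
  hence "(\<Sum>j\<in>UNIV. (1 / real CARD('n)) *\<^sub>R ?l j) \<in> K"
    using K by (intro convex_sum) (auto simp: admissible_cone_def)
  moreover have "(\<Sum>j\<in>UNIV. (1 / real CARD('n)) *\<^sub>R ?l j) = 0"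
  proof -
    have "(\<Sum>j\<in>UNIV. axis j 1 $ i) = (1::real)" for i :: 'n by (simp add: axis_def)
    hence "(\<Sum>j\<in>UNIV. axis j 1) = ((\<chi> i. 1) :: real^'n)" by (simp add: vec_eq_iff)
    hence "(\<Sum>j\<in>UNIV. ?l j) = 0"
      by (simp only: scaleR_sum_right[symmetric] sum_subtractf sum_constant_scaleR) simp
    thus ?thesis by (simp add: scaleR_sum_right[symmetric])
  qed
  ultimately show False using admissible_cone_zero_notin[OF K] by simp
qed

section \<open>The effect of the map P on the cones\<close>

text \<open>The inverse of \<open>P\<close>, obtained from the fact that \<open>P\<close> multiplies the sum of the entries
  by \<open>n - \<rho>\<close>.\<close>

definition P_inv :: "real \<Rightarrow> real^'n \<Rightarrow> real^'n" where
  "P_inv \<rho> m = (1 / \<rho>) *\<^sub>R (((\<Sum>j\<in>UNIV. m $ j) / (real CARD('n) - \<rho>)) *\<^sub>R (\<chi> i. 1) - m)"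

lemma linear_P_map: "linear (P_map \<rho>)"
  by (rule linearI) (simp_all add: P_map_def vec_eq_iff sum.distrib sum_distrib_left[symmetric] algebra_simps)

lemma P_map_nth: "P_map \<rho> l $ i = (\<Sum>j\<in>UNIV. l $ j) - \<rho> * l $ i"
  by (simp add: P_map_def)

lemma P_inv_nth:
  "P_inv \<rho> (m :: real^'n) $ i = ((\<Sum>j\<in>UNIV. m $ j) / (real CARD('n) - \<rho>) - m $ i) / \<rho>"
  by (simp add: P_inv_def)

lemma P_map_inverse:
  fixes l :: "real^'n"
  assumes "0 < \<rho>" "\<rho> < real CARD('n)"
  shows "P_inv \<rho> (P_map \<rho> l) = l" and "P_map \<rho> (P_inv \<rho> l) = l"
proof -
  have "(\<Sum>j\<in>UNIV. P_map \<rho> l $ j) = (real CARD('n) - \<rho>) * (\<Sum>j\<in>UNIV. l $ j)"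
    by (simp add: P_map_nth sum_subtractf sum_distrib_left[symmetric] algebra_simps)
  thus "P_inv \<rho> (P_map \<rho> l) = l" using assms by (simp add: vec_eq_iff P_inv_nth) (simp add: P_map_nth)
  have "(\<Sum>j\<in>UNIV. P_inv \<rho> l $ j) = (\<Sum>j\<in>UNIV. l $ j) / (real CARD('n) - \<rho>)"
    using assms by (simp add: P_inv_nth sum_subtractf sum_divide_distrib[symmetric]) (simp add: field_simps)
  thus "P_map \<rho> (P_inv \<rho> l) = l" using assms by (simp add: vec_eq_iff P_map_nth) (simp add: P_inv_nth)
qed

lemma interior_P_map_image_iff:
  fixes C :: "(real^'n) set"
  assumes "0 < \<rho>" "\<rho> < real CARD('n)"
  shows "m \<in> interior (P_map \<rho> ` C) \<longleftrightarrow> P_inv \<rho> m \<in> interior C"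
proof -
  have "inj (P_map \<rho> :: real^'n \<Rightarrow> _)" using P_map_inverse(1)[OF assms] by (metis injI)
  hence "interior (P_map \<rho> ` C) = P_map \<rho> ` interior C"
    by (intro interior_injective_linear_image linear_P_map)
  thus ?thesis using P_map_inverse[OF assms] by (metis imageE imageI)
qed

lemma cone_G_P_map_image:
  fixes f f' :: "real^'n \<Rightarrow> real"
  assumes K: "\<And>l t. l \<in> K \<Longrightarrow> 0 < t \<Longrightarrow> t *\<^sub>R l \<in> K" and f': "\<And>l. l \<in> K \<Longrightarrow> f' (P_map \<rho> l) = f l"
  shows "cone_G f' (P_map \<rho> ` K) = P_map \<rho> ` cone_G f K"
proof -
  have "((\<lambda>s. ereal (f' (s *\<^sub>R P_map \<rho> l))) \<longlongrightarrow> L) at_top \<longleftrightarrow>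
      ((\<lambda>s. ereal (f (s *\<^sub>R l))) \<longlongrightarrow> L) at_top" if l: "l \<in> K" for l L
  proof (rule tendsto_cong)
    show "\<forall>\<^sub>F s in at_top. ereal (f' (s *\<^sub>R P_map \<rho> l)) = ereal (f (s *\<^sub>R l))"
      using eventually_gt_at_top[of "0::real"]
      by eventually_elim (simp add: f' K[OF l] linear_cmul[OF linear_P_map, symmetric])
  qed
  thus ?thesis by (auto simp: cone_G_def)
qed

lemma sum_ray: "(\<Sum>j\<in>UNIV. (ray r :: real^'n::{finite,linorder}) $ j) = real CARD('n) - r"
proof -
  have "(\<Sum>j\<in>UNIV. (ray r :: real^'n::{finite,linorder}) $ j) = (\<Sum>j\<in>UNIV. 1 - (if j = (Max UNIV :: 'n) then r else 0))"
    by (intro sum.cong) (auto simp: ray_nth)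
  thus ?thesis by (simp add: sum_subtractf)
qed

lemma P_inv_ray_nth:
  "P_inv \<rho> (ray r :: real^'n::{finite,linorder}) $ i =
    ((real CARD('n) - r) / (real CARD('n) - \<rho>) - (if i = Max UNIV then 1 - r else 1)) / \<rho>"
  unfolding P_inv_nth sum_ray ray_nth ..

text \<open>This is why \<open>(0,\<dots>,0,1)\<close> decides whether \<open>\<rho>\<close> is smaller than the exit parameter of the image
  cone.\<close>

lemma P_inv_ray_self:
  assumes "0 < \<rho>" "\<rho> < real CARD('n::{finite,linorder})"
  shows "P_inv \<rho> (ray \<rho>) = (axis (Max UNIV) 1 :: real^'n::{finite,linorder})"
  using assms by (simp add: vec_eq_iff P_inv_ray_nth axis_def)

lemma P_inv_ray_positive:
  assumes "0 < \<rho>" "\<rho> < real CARD('n::{finite,linorder})" "0 \<le> r" "r < \<rho>"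
  shows "P_inv \<rho> (ray r) \<in> (positive_cone :: (real^'n::{finite,linorder}) set)"
proof -
  define q where "q = (real CARD('n) - r) / (real CARD('n) - \<rho>)"
  have q: "1 < q" using assms by (simp add: q_def)
  have "0 < (q - (if i = Max UNIV then 1 - r else 1)) / \<rho>" for i :: 'n
    using assms(1,3) q by (cases "i = Max UNIV") simp_all
  thus ?thesis unfolding positive_cone_def mem_Collect_eq P_inv_ray_nth q_def by (rule allI)
qed

text \<open>For \<open>r \<le> 0\<close> the first \<open>n - 1\<close> entries of the preimage share a positive value, and dividing by it
  gives a point \<open>ray t\<close>.  The last entry may be negative, so the preimage need not be positive; the
  bound on \<open>t\<close> is what is compared with \<open>rho_G f \<Gamma>\<close>.\<close>

lemma P_inv_ray_nonpos:
  assumes "0 < \<rho>" "\<rho> < real CARD('n::{finite,linorder})" "r \<le> 0"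
  obtains t c where "t < real CARD('n) - \<rho>" "0 < c"
    "P_inv \<rho> (ray r) = (c *\<^sub>R ray t :: real^'n::{finite,linorder})"
proof
  let ?d = "real CARD('n) - \<rho>"
  let ?t = "- r * ?d / (\<rho> - r)" and ?c = "(\<rho> - r) / (?d * \<rho>)"
  have d: "0 < ?d" "0 < \<rho> - r" using assms by auto
  have "- r * ?d < ?d * (\<rho> - r)" using d assms by (simp add: algebra_simps)
  thus "?t < ?d" using d(2) by (simp only: pos_divide_less_eq)
  show "0 < ?c" using d assms by simp
  have "(real CARD('n) - r) / ?d = (?d + (\<rho> - r)) / ?d" by simp
  also have "\<dots> = 1 + (\<rho> - r) / ?d" using d(1) by (simp only: add_divide_distrib) simp
  finally have 1: "(real CARD('n) - r) / ?d = 1 + (\<rho> - r) / ?d" .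
  have 2: "?c * (1 - ?t) = ((\<rho> - r) / ?d + r) / \<rho>"
  proof -
    have "(\<rho> - r) * ?t = - r * ?d" using d(2) by simp
    hence "(\<rho> - r) * (1 - ?t) = (\<rho> - r) + r * ?d" by (simp only: right_diff_distrib) simp
    hence "?c * (1 - ?t) = ((\<rho> - r) + r * ?d) / (?d * \<rho>)" by (metis times_divide_eq_left)
    also have "\<dots> = ((\<rho> - r) / ?d + r) / \<rho>"
      using d(1) by (simp only: divide_divide_eq_left[symmetric] add_divide_distrib) simp
    finally show ?thesis .
  qed
  show "P_inv \<rho> (ray r) = (?c *\<^sub>R ray ?t :: real^'n::{finite,linorder})"
  proof (intro vec_eq_iff[THEN iffD2] allI)
    fix i :: 'n
    show "P_inv \<rho> (ray r) $ i = (?c *\<^sub>R ray ?t) $ i"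
      unfolding P_inv_ray_nth 1 vector_scaleR_component ray_nth
    proof (cases "i = Max UNIV")
      case True
      have "1 + x - (1 - r) = x + r" for x :: real by simp
      thus "(1 + (\<rho> - r) / ?d - (if i = Max UNIV then 1 - r else 1)) / \<rho> =
          ?c *\<^sub>R (if i = Max UNIV then 1 - ?t else 1)"
        by (simp only: if_P[OF True] real_scaleR_def 2)
    next
      case False
      have "1 + x - 1 = x" for x :: real by simp
      thus "(1 + (\<rho> - r) / ?d - (if i = Max UNIV then 1 - r else 1)) / \<rho> =
          ?c *\<^sub>R (if i = Max UNIV then 1 - ?t else 1)"
        by (simp only: if_not_P[OF False] real_scaleR_def divide_divide_eq_left mult_1_right)
    qed
  qed
qed

lemma P_inv_ray_dimension:
  assumes "0 < \<rho>" "\<rho> < real CARD('n::{finite,linorder})"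
  shows "P_inv \<rho> (ray (real CARD('n))) =
    (- 1 / \<rho>) *\<^sub>R ((\<chi> i. 1) - real CARD('n) *\<^sub>R axis (Max UNIV) 1 :: real^'n::{finite,linorder})"
  using assms by (simp add: vec_eq_iff P_inv_ray_nth axis_def diff_divide_distrib)

text \<open>The cone half of the proposition.  Both \<open>C\<close> and \<open>C' = P(C)\<close> are convex, contain \<open>ray r\<close> in the
  interior for \<open>r \<le> 0\<close>, and do not contain \<open>ray n\<close>, which has entries of sum \<open>0\<close> and of which the
  inverse of \<open>P\<close> gives a multiple.  So \<open>rho_G\<close> describes in both cases which points of the line
  are interior.\<close>

theorem rho_G_P_map_image:
  fixes f f' :: "real^'n::{finite,linorder} \<Rightarrow> real"
    and \<Gamma> :: "(real^'n::{finite,linorder}) set"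
  assumes pair: "admissible_pair f \<Gamma>" and f: "concave_on \<Gamma> f"
    and mono: "\<And>l i. l \<in> \<Gamma> \<Longrightarrow> 0 < frechet_derivative f (at l) (axis i 1)"
    and \<rho>: "0 < \<rho>" "real CARD('n) - rho_G f \<Gamma> \<le> \<rho>" "\<rho> < real CARD('n)"
    and f': "\<And>l. l \<in> \<Gamma> \<Longrightarrow> f' (P_map \<rho> l) = f l"
  shows "\<rho> \<le> rho_G f' (P_map \<rho> ` \<Gamma>)"
    and "axis (Max UNIV) 1 \<in> interior (cone_G f \<Gamma>) \<longleftrightarrow> \<rho> < rho_G f' (P_map \<rho> ` \<Gamma>)"
proof -
  let ?C = "cone_G f \<Gamma>" and ?C' = "cone_G f' (P_map \<rho> ` \<Gamma>)"
  let ?n = "real CARD('n)"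
  have adm: "admissible_cone \<Gamma>" using pair by (simp add: admissible_pair_def)
  hence K: "\<And>l t. l \<in> \<Gamma> \<Longrightarrow> 0 < t \<Longrightarrow> t *\<^sub>R l \<in> \<Gamma>" and open_\<Gamma>: "open \<Gamma>" and pos: "positive_cone \<subseteq> \<Gamma>"
    by (auto simp: admissible_cone_def)
  have diff: "(f has_derivative frechet_derivative f (at l)) (at l)" if "l \<in> \<Gamma>" for l
    using Ck_on_has_derivative[OF _ _ open_\<Gamma> that] pair by (auto simp: admissible_pair_def)
  have "positive_cone \<subseteq> ?C"
    by (rule positive_cone_subset_cone_G[OF f K pos diff mono])
  hence pos_C: "positive_cone \<subseteq> interior ?C" by (simp add: interior_maximal open_positive_cone)
  have C: "convex ?C" by (rule convex_cone_G[OF f K])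
  have off: "c *\<^sub>R ((\<chi> i. 1) - ?n *\<^sub>R axis (Max UNIV) 1) \<notin> interior ?C" for c
    using admissible_cone_trace_free_notin[OF adm, of c "Max UNIV"] interior_subset
    by (auto simp: cone_G_def)
  have rho_f: "ray r \<in> interior ?C \<longleftrightarrow> r < rho_G f \<Gamma>" for r
  proof (rule ray_interior_cone_G_iff[OF C])
    show "ray r \<in> interior ?C" if "r \<le> 0" for r
      using pos_C that by (auto simp: positive_cone_def ray_nth)
    have "ray ?n = (1 *\<^sub>R ((\<chi> i. 1) - ?n *\<^sub>R axis (Max UNIV) 1) :: real^'n::{finite,linorder})"
      by (simp add: vec_eq_iff ray_nth axis_def)
    thus "ray ?n \<notin> interior ?C" using off[of 1] by simp
  qed
  have C': "?C' = P_map \<rho> ` ?C" by (rule cone_G_P_map_image[where f = f, OF K f'])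
  have int_C': "m \<in> interior ?C' \<longleftrightarrow> P_inv \<rho> m \<in> interior ?C" for m
    unfolding C' by (rule interior_P_map_image_iff[OF \<rho>(1,3)])
  have rho_f': "ray r \<in> interior ?C' \<longleftrightarrow> r < rho_G f' (P_map \<rho> ` \<Gamma>)" for r
  proof (rule ray_interior_cone_G_iff)
    show "convex ?C'" unfolding C' by (rule convex_linear_image[OF linear_P_map C])
    show "ray r \<in> interior ?C'" if r: "r \<le> 0" for r
    proof -
      obtain t c where tc: "t < ?n - \<rho>" "0 < c"
        "P_inv \<rho> (ray r) = (c *\<^sub>R ray t :: real^'n::{finite,linorder})"
        using P_inv_ray_nonpos[OF \<rho>(1,3) r] .
      have t: "ray t \<in> interior ?C" using tc(1) \<rho>(2) rho_f by simp
      show ?thesis unfolding int_C' tc(3) by (rule interior_cone_G_scaleR[OF K t tc(2)])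
    qed
    show "ray ?n \<notin> interior ?C'"
      unfolding int_C' P_inv_ray_dimension[OF \<rho>(1,3)] by (rule off)
  qed
  show "\<rho> \<le> rho_G f' (P_map \<rho> ` \<Gamma>)"
  proof (rule ccontr)
    assume less: "\<not> ?thesis"
    define r where "r = max 0 (rho_G f' (P_map \<rho> ` \<Gamma>))"
    have r: "0 \<le> r" "rho_G f' (P_map \<rho> ` \<Gamma>) \<le> r" "r < \<rho>"
      using less \<rho>(1) by (auto simp: r_def)
    hence "ray r \<in> interior ?C'"
      using P_inv_ray_positive[OF \<rho>(1,3), of r] pos_C by (auto simp: int_C')
    thus False using r rho_f' by simp
  qed
  show "axis (Max UNIV) 1 \<in> interior ?C \<longleftrightarrow> \<rho> < rho_G f' (P_map \<rho> ` \<Gamma>)"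
    unfolding rho_f'[symmetric] int_C' P_inv_ray_self[OF \<rho>(1,3)] ..
qed

section \<open>Simultaneous diagonalization of a definite pencil\<close>

definition diag :: "'a::zero^'n \<Rightarrow> 'a^'n^'n" where
  "diag d = (\<chi> i j. if i = j then d $ i else 0)"

lemma inner_matrix_symmetric:
  fixes A :: "real^'n^'n"
  assumes "transpose A = A"
  shows "x \<bullet> (A *v y) = y \<bullet> (A *v x)"
  by (metis assms dot_lmul_matrix inner_commute transpose_matrix_vector)

text \<open>If the mixed term \<open>b\<close> were nonzero, the quadratic polynomial \<open>2 b t + c t\<^sup>2\<close>, the value of the form
  at \<open>w + t z\<close>, would be negative for small \<open>t\<close> of sign opposite to \<open>b\<close>.\<close>

lemma psd_zero_imp_orthogonal:
  fixes S :: "real^'n^'n"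
  assumes S: "transpose S = S" and W: "subspace W" "w \<in> W" "z \<in> W"
    and psd: "\<And>v. v \<in> W \<Longrightarrow> 0 \<le> v \<bullet> (S *v v)" and w: "w \<bullet> (S *v w) = 0"
  shows "z \<bullet> (S *v w) = 0"
proof (rule ccontr)
  let ?b = "z \<bullet> (S *v w)" and ?c = "z \<bullet> (S *v z)"
  assume b: "?b \<noteq> 0"
  have q: "0 \<le> 2 * t * ?b + t\<^sup>2 * ?c" for t
  proof -
    have "w + t *\<^sub>R z \<in> W" using W by (simp add: subspace_add subspace_scale)
    from psd[OF this] have "0 \<le> (w + t *\<^sub>R z) \<bullet> (S *v (w + t *\<^sub>R z))" .
    also have "\<dots> = 2 * t * ?b + t\<^sup>2 * ?c"
      using w inner_matrix_symmetric[OF S, of w z]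
      by (simp add: matrix_vector_right_distrib matrix_vector_mult_scaleR inner_add_left
          inner_add_right power2_eq_square algebra_simps)
    finally show ?thesis .
  qed
  have c: "0 \<le> ?c" using psd W by blast
  define t where "t = - ?b / (?c + 1)"
  have t: "?b = - t * (?c + 1)" "t \<noteq> 0" using b c by (simp_all add: t_def)
  have "2 * t * ?b + t\<^sup>2 * ?c = - (t\<^sup>2 * (?c + 2))"
    unfolding t(1) by (simp add: algebra_simps power2_eq_square)
  moreover have "0 < t\<^sup>2 * (?c + 2)" using t(2) c by simp
  ultimately show False using q[of t] by linarith
qed

text \<open>\<open>G\<close> is the metric and \<open>T\<close> a symmetric tensor at one point, in one chart.\<close>

locale pencil =
  fixes G T :: "real^'n^'n"
  assumes G_sym: "transpose G = G" and T_sym: "transpose T = T"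
    and G_pos: "v \<noteq> 0 \<Longrightarrow> 0 < v \<bullet> (G *v v)"
begin

lemma G_invertible: "invertible G"
proof -
  have "x = 0" if "G *v x = 0" for x using G_pos[of x] that by fastforce
  thus ?thesis by (metis invertible_left_inverse matrix_left_invertible_ker)
qed

lemma G_inv: "matrix_inv G ** G = mat 1" "G ** matrix_inv G = mat 1"
proof -
  have "\<exists>A'. G ** A' = mat 1 \<and> A' ** G = mat 1" using G_invertible by (simp add: invertible_def)
  from someI_ex[OF this] show "matrix_inv G ** G = mat 1" "G ** matrix_inv G = mat 1"
    by (auto simp: matrix_inv_def)
qed

definition eigenvector :: "real \<Rightarrow> real^'n \<Rightarrow> bool" where
  "eigenvector \<mu> v \<longleftrightarrow> v \<noteq> 0 \<and> T *v v = \<mu> *\<^sub>R (G *v v)"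

text \<open>On the \<open>G\<close>-orthogonal complement \<open>W\<close> of \<open>B\<close> the Rayleigh quotient attains a maximum \<open>\<mu>\<close>, at \<open>w\<close> say.
  Then the form of \<open>S = \<mu> G - T\<close> is nonnegative on \<open>W\<close> and vanishes at \<open>w\<close>, so \<open>S w\<close> is orthogonal
  to \<open>W\<close>; it is orthogonal to \<open>B\<close> because \<open>B\<close> consists of eigenvectors.  These two facts force
  \<open>S w = 0\<close>.\<close>

lemma exists_orthogonal_eigenvector:
  assumes B: "finite B" "card B < CARD('n)" and ev: "\<And>b. b \<in> B \<Longrightarrow> \<exists>\<mu>. eigenvector \<mu> b"
  obtains w \<mu> where "eigenvector \<mu> w" "\<And>b. b \<in> B \<Longrightarrow> b \<bullet> (G *v w) = 0"
proof -
  define W where "W = {w. \<forall>b\<in>B. b \<bullet> (G *v w) = 0}"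
  have W: "subspace W"
    by (auto simp: W_def subspace_def matrix_vector_right_distrib matrix_vector_mult_scaleR
        inner_add_right)
  have "dim ((*v) G ` B) < DIM(real^'n)"
    using dim_le_card'[of "(*v) G ` B"] card_image_le[of B "(*v) G"] B by simp
  then obtain v where v: "v \<noteq> 0" "\<And>y. y \<in> span ((*v) G ` B) \<Longrightarrow> orthogonal v y"
    by (rule orthogonal_to_subspace_exists) blast
  have vW: "v \<in> W"
    using v(2)[OF span_base] by (auto simp: W_def orthogonal_def inner_matrix_symmetric[OF G_sym, of _ v])
  let ?C = "sphere 0 1 \<inter> W"
  let ?R = "\<lambda>w. (w \<bullet> (T *v w)) / (w \<bullet> (G *v w))"
  have "compact ?C" using W closed_subspace by (blast intro: compact_Int_closed compact_sphere)
  moreover have "v /\<^sub>R norm v \<in> ?C" using v(1) vW W by (simp add: subspace_scale)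
  moreover have "continuous_on ?C ?R"
  proof (intro continuous_intros matrix_vector_mult_linear_continuous_on ballI)
    fix z assume "z \<in> ?C"
    hence "z \<noteq> 0" by auto
    thus "z \<bullet> (G *v z) \<noteq> 0" using G_pos[of z] by simp
  qed
  ultimately obtain w where w: "w \<in> ?C" "\<And>z. z \<in> ?C \<Longrightarrow> ?R z \<le> ?R w"
    using continuous_attains_sup[of ?C ?R] by blast
  define \<mu> where "\<mu> = ?R w"
  define S where "S = \<mu> *\<^sub>R G - T"
  have S_app: "S *v z = \<mu> *\<^sub>R (G *v z) - T *v z" for z
    by (simp add: S_def matrix_vector_mult_diff_rdistrib scaleR_matrix_vector_assoc)
  have S: "transpose S = S"
    using G_sym T_sym by (simp add: S_def transpose_def vec_eq_iff)
  have w0: "w \<noteq> 0" "w \<in> W" using w by auto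
  have "w \<bullet> (S *v w) = 0"
    using G_pos[OF w0(1)] by (simp add: S_app \<mu>_def inner_diff_right)
  moreover have "0 \<le> z \<bullet> (S *v z)" if "z \<in> W" for z
  proof (cases "z = 0")
    case False
    have "z /\<^sub>R norm z \<in> ?C" using False that W by (simp add: subspace_scale)
    from w(2)[OF this] have "?R z \<le> \<mu>"
      using False by (simp add: \<mu>_def matrix_vector_mult_scaleR)
    thus ?thesis using G_pos[OF False] by (simp add: S_app inner_diff_right pos_divide_le_eq)
  qed simp
  ultimately have orthW: "z \<bullet> (S *v w) = 0" if "z \<in> W" for z
    using psd_zero_imp_orthogonal[OF S W w0(2) that] by blast
  have orthB: "b \<bullet> (S *v w) = 0" if b: "b \<in> B" for b
  proof -
    obtain \<nu> where "eigenvector \<nu> b" using ev b by blast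
    hence "S *v b = (\<mu> - \<nu>) *\<^sub>R (G *v b)"
      by (simp add: S_app eigenvector_def scaleR_diff_left)
    hence "w \<bullet> (S *v b) = (\<mu> - \<nu>) * (b \<bullet> (G *v w))"
      by (simp add: inner_matrix_symmetric[OF G_sym, of w])
    thus ?thesis using w0(2) b by (simp add: W_def inner_matrix_symmetric[OF S, of b])
  qed
  \<comment> \<open>Orthogonality of \<open>S w\<close> to \<open>B\<close> puts \<open>z = G\<^sup>-\<^sup>1 S w\<close> into \<open>W\<close>, and then \<open>S w\<close> is orthogonal to \<open>z\<close>.\<close>
  have "S *v w = 0"
  proof -
    define z where "z = matrix_inv G *v (S *v w)"
    have Gz: "G *v z = S *v w" by (simp only: z_def matrix_vector_mul_assoc[of G] G_inv matrix_vector_mul_lid)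
    have "z \<in> W" using orthB by (simp add: W_def Gz)
    hence "z \<bullet> (G *v z) = 0" using orthW Gz by simp
    hence "z = 0" using G_pos by fastforce
    thus ?thesis using Gz by simp
  qed
  hence "eigenvector \<mu> w" using w0 by (simp add: eigenvector_def S_app)
  thus ?thesis using that w0(2) by (auto simp: W_def)
qed

lemma exists_orthogonal_eigenvectors:
  assumes "k \<le> CARD('n)"
  shows "\<exists>B. finite B \<and> card B = k \<and> (\<forall>b\<in>B. \<exists>\<mu>. eigenvector \<mu> b) \<and>
    pairwise (\<lambda>b c. b \<bullet> (G *v c) = 0) B"
  using assms
proof (induction k)
  case 0
  show ?case by (intro exI[of _ "{}"]) (simp add: pairwise_def)
next
  case (Suc k)
  then obtain B where B: "finite B" "card B = k" "\<And>b. b \<in> B \<Longrightarrow> \<exists>\<mu>. eigenvector \<mu> b"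
    "pairwise (\<lambda>b c. b \<bullet> (G *v c) = 0) B" by auto
  obtain w \<mu> where w: "eigenvector \<mu> w" "\<And>b. b \<in> B \<Longrightarrow> b \<bullet> (G *v w) = 0"
    using exists_orthogonal_eigenvector[of B] B(1-3) Suc.prems by (metis Suc_le_eq)
  have "w \<notin> B" using w G_pos by (fastforce simp: eigenvector_def)
  moreover have "w \<bullet> (G *v b) = 0" if "b \<in> B" for b
    using w(2)[OF that] by (simp add: inner_matrix_symmetric[OF G_sym, of w])
  ultimately show ?case
    using B w by (intro exI[of _ "insert w B"]) (auto simp: pairwise_insert)
qed

text \<open>The columns of \<open>Q\<close> are \<open>n\<close> pairwise \<open>G\<close>-orthogonal eigenvectors.  Their Gram matrix with respect to
  \<open>G\<close> is diagonal with positive entries, which yields the invertibility of \<open>Q\<close>.\<close>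

theorem simultaneous_diagonalization:
  obtains Q :: "real^'n^'n" and d where "invertible Q" "matrix_inv G ** T ** Q = Q ** diag d"
proof -
  obtain B where B: "finite B" "card B = CARD('n)" "\<And>b. b \<in> B \<Longrightarrow> \<exists>\<mu>. eigenvector \<mu> b"
    "pairwise (\<lambda>b c. b \<bullet> (G *v c) = 0) B"
    using exists_orthogonal_eigenvectors[OF order_refl] by auto
  obtain v where v: "bij_betw v (UNIV :: 'n set) B"
    using finite_same_card_bij[OF finite B(1)] B(2) by auto
  have "\<forall>i. \<exists>\<mu>. eigenvector \<mu> (v i)" using v B(3) by (auto simp: bij_betw_def)
  then obtain d0 where d0: "\<And>i. eigenvector (d0 i) (v i)" by metis
  define Q where "Q = (\<chi> r i. v i $ r)"
  define d where "d = (\<chi> i. d0 i)"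
  have column: "M ** Q = (\<chi> r i. (M *v v i) $ r)" for M :: "real^'n^'n"
    by (simp add: Q_def matrix_matrix_mult_def matrix_vector_mult_def)
  have orth: "v i \<bullet> (G *v v j) = 0" if "i \<noteq> j" for i j
  proof -
    have "v i \<in> B" "v j \<in> B" "v i \<noteq> v j"
      using v that by (auto simp: bij_betw_def inj_def)
    thus ?thesis using B(4) by (simp add: pairwise_def)
  qed
  have gram: "(transpose Q ** (G ** Q)) $ i $ j = v i \<bullet> (G *v v j)" for i j
    by (simp add: column) (simp add: matrix_matrix_mult_def transpose_def Q_def inner_vec_def)
  have "det (transpose Q ** (G ** Q)) = (\<Prod>i\<in>UNIV. v i \<bullet> (G *v v i))"
    by (subst det_diagonal) (simp_all add: gram orth)
  also have "\<dots> \<noteq> 0"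
    using d0 G_pos by (simp add: eigenvector_def) (metis less_irrefl)
  finally have "det Q \<noteq> 0" by (auto simp: det_mul)
  hence "invertible Q" by (simp add: invertible_det_nz)
  moreover have "matrix_inv G ** T ** Q = Q ** diag d"
  proof -
    have "(matrix_inv G ** T) *v v i = d $ i *\<^sub>R v i" for i
    proof -
      have "T *v v i = d $ i *\<^sub>R (G *v v i)" using d0 by (simp add: eigenvector_def d_def)
      hence "matrix_inv G *v (T *v v i) = d $ i *\<^sub>R (matrix_inv G *v (G *v v i))"
        by (simp add: matrix_vector_mult_scaleR)
      thus ?thesis by (simp add: matrix_vector_mul_assoc G_inv)
    qed
    moreover have "Q ** diag d = (\<chi> r i. (d $ i *\<^sub>R v i) $ r)"
      by (simp add: vec_eq_iff Q_def diag_def matrix_matrix_mult_def if_distrib[of "\<lambda>x. _ * x"]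
          cong: if_cong)
    ultimately show ?thesis by (simp add: column)
  qed
  ultimately show ?thesis using that by blast
qed

end

lemma diagonalization_affine:
  fixes A Q :: "real^'n^'n"
  assumes "A ** Q = Q ** diag d"
  shows "(a *\<^sub>R mat 1 + b *\<^sub>R A) ** Q = Q ** diag (\<chi> i. a + b * d $ i)"
proof -
  have "(a *\<^sub>R mat 1 + b *\<^sub>R A) ** Q = a *\<^sub>R Q + b *\<^sub>R (A ** Q)"
  proof -
    have "(X + Y) ** Q = X ** Q + Y ** Q" for X Y :: "real^'n^'n"
      by (simp add: vec_eq_iff matrix_matrix_mult_def distrib_right sum.distrib)
    thus ?thesis by (simp add: scalar_matrix_assoc[symmetric])
  qed
  also have "\<dots> = Q ** (a *\<^sub>R mat 1 + b *\<^sub>R diag d)"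
    by (simp add: assms matrix_add_ldistrib matrix_scalar_ac scalar_matrix_assoc[symmetric])
  also have "a *\<^sub>R mat 1 + b *\<^sub>R diag d = diag (\<chi> i. a + b * d $ i)"
    by (simp add: vec_eq_iff diag_def mat_def)
  finally show ?thesis .
qed

lemma char_poly_of_diagonalization:
  fixes A Q :: "real^'n^'n"
  assumes Q: "invertible Q" and A: "A ** Q = Q ** diag d"
  shows "det (A - mat t) = (\<Prod>i\<in>UNIV. d $ i - t)"
proof -
  have "A - mat t = (- t) *\<^sub>R mat 1 + 1 *\<^sub>R A"
    by (simp add: vec_eq_iff mat_def)
  hence "(A - mat t) ** Q = Q ** diag (\<chi> i. d $ i - t)"
    using diagonalization_affine[OF A, of "- t" 1] by simp
  from arg_cong[OF this, of det]
  have "det (A - mat t) * det Q = det (diag (\<chi> i. d $ i - t)) * det Q"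
    by (simp only: det_mul mult.commute)
  moreover have "det (diag (\<chi> i. d $ i - t)) = (\<Prod>i\<in>UNIV. d $ i - t)"
    by (subst det_diagonal) (simp_all add: diag_def)
  ultimately show ?thesis using Q by (simp add: invertible_det_nz)
qed

lemma trace_of_diagonalization:
  fixes A Q :: "real^'n^'n"
  assumes Q: "invertible Q" and A: "A ** Q = Q ** diag d"
  shows "trace A = (\<Sum>i\<in>UNIV. d $ i)"
proof -
  obtain R where R: "Q ** R = mat 1" "R ** Q = mat 1" using Q by (auto simp: invertible_def)
  have "trace A = trace ((A ** Q) ** R)" by (simp only: matrix_mul_assoc[symmetric] R matrix_mul_rid)
  also have "\<dots> = trace (R ** (Q ** diag d))" by (simp only: A trace_mul_sym[of _ R])
  also have "\<dots> = trace (diag d)" by (simp only: matrix_mul_assoc R matrix_mul_lid)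
  finally show ?thesis by (simp add: trace_def diag_def)
qed

text \<open>Both tuples list the roots, with multiplicity, of the same polynomial.\<close>

lemma eigenvalue_tuple_unique_up_to_permutation:
  fixes G T :: "real^'n^'n"
  assumes "eigenvalue_tuple G T a" and "eigenvalue_tuple G T b"
  obtains \<pi> where "\<pi> permutes UNIV" "b = (\<chi> i. a $ \<pi> i)"
proof -
  let ?p = "\<lambda>c::real^'n. \<Prod>i\<in>UNIV. [:- (c $ i), 1:]"
  have roots: "proots (?p c) = image_mset (($) c) (mset_set UNIV)" for c
  proof -
    have "proots (?p c) = (\<Sum>i\<in>UNIV. proots [:- (c $ i), 1:])"
      by (intro proots_prod) simp
    also have "\<dots> = (\<Sum>i\<in>UNIV. {#c $ i#})"
      by (intro sum.cong) (simp_all only: proots_linear_factor minus_minus)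
    also have "\<dots> = image_mset (($) c) (mset_set UNIV)" by (simp add: sum_unfold_sum_mset)
    finally show ?thesis .
  qed
  have "(\<Prod>i\<in>UNIV. a $ i - t) = (\<Prod>i\<in>UNIV. b $ i - t)" for t
    using assms by (simp add: eigenvalue_tuple_def)
  moreover have "poly (?p c) t = (-1) ^ CARD('n) * (\<Prod>i\<in>UNIV. c $ i - t)" for c t
    by (simp add: poly_prod prod_uminus[symmetric])
  ultimately have "poly (?p a) t = poly (?p b) t" for t by simp
  hence "?p a = ?p b" by (simp only: poly_eq_poly_eq_iff[symmetric] fun_eq_iff) simp
  hence "image_mset (($) b) (mset_set UNIV) = image_mset (($) a) (mset_set UNIV)"
    by (simp only: roots[symmetric])
  then obtain \<pi> where "\<pi> permutes UNIV" "\<forall>i\<in>UNIV. b $ i = a $ \<pi> i"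
    using image_mset_eq_implies_permutes[OF finite] by blast
  thus ?thesis using that by (simp add: vec_eq_iff)
qed

context pencil
begin

lemma eigenvalue_tuple_of_diagonalization:
  assumes "invertible Q" "matrix_inv G ** T ** Q = Q ** diag d"
  shows "eigenvalue_tuple G T d"
  using char_poly_of_diagonalization[OF assms] by (simp add: eigenvalue_tuple_def)

lemma eigenvalue_tuple_exists: "\<exists>l. eigenvalue_tuple G T l"
  by (rule simultaneous_diagonalization) (blast dest: eigenvalue_tuple_of_diagonalization)

text \<open>The matrix \<open>Q\<close> that diagonalizes \<open>A = G\<^sup>-\<^sup>1T\<close> also diagonalizes \<open>tr(A) I - \<rho> A\<close>, and \<open>tr(A)\<close> is the
  sum of the eigenvalues.  A permutation mediates between the diagonal entries and the given tuple.\<close>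

lemma eigenvalue_tuple_P_map:
  assumes "eigenvalue_tuple G T l"
  shows "eigenvalue_tuple G (trace (matrix_inv G ** T) *\<^sub>R G - \<rho> *\<^sub>R T) (P_map \<rho> l)"
proof -
  obtain Q :: "real^'n^'n" and d where Q: "invertible Q" and d: "matrix_inv G ** T ** Q = Q ** diag d"
    using simultaneous_diagonalization .
  obtain \<pi> where \<pi>: "\<pi> permutes UNIV" "l = (\<chi> i. d $ \<pi> i)"
    using eigenvalue_tuple_unique_up_to_permutation[OF eigenvalue_tuple_of_diagonalization[OF Q d] assms] .
  define \<tau> where "\<tau> = trace (matrix_inv G ** T)"
  have \<tau>: "\<tau> = (\<Sum>i\<in>UNIV. d $ i)" unfolding \<tau>_def by (rule trace_of_diagonalization[OF Q d])
  also have "\<dots> = (\<Sum>i\<in>UNIV. l $ i)" using sum.permute[OF \<pi>(1), of "($) d"] by (simp add: \<pi>(2) o_def)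
  finally have P: "P_map \<rho> l $ i = \<tau> - \<rho> * d $ \<pi> i" for i by (simp add: P_map_nth \<pi>(2))
  have "matrix_inv G ** (\<tau> *\<^sub>R G - \<rho> *\<^sub>R T) = \<tau> *\<^sub>R mat 1 + (- \<rho>) *\<^sub>R (matrix_inv G ** T)"
  proof -
    have "\<tau> *\<^sub>R G - \<rho> *\<^sub>R T = \<tau> *\<^sub>R G + (- \<rho>) *\<^sub>R T" by simp
    thus ?thesis
      by (simp only: matrix_add_ldistrib matrix_scalar_ac scalar_matrix_assoc[symmetric] G_inv)
  qed
  hence "det (matrix_inv G ** (\<tau> *\<^sub>R G - \<rho> *\<^sub>R T) - mat t) = (\<Prod>i\<in>UNIV. \<tau> - \<rho> * d $ i - t)" for t
    using char_poly_of_diagonalization[OF Q diagonalization_affine[OF d, of \<tau> "- \<rho>"], of t] by simp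
  also have "(\<Prod>i\<in>UNIV. \<tau> - \<rho> * d $ i - t) = (\<Prod>i\<in>UNIV. P_map \<rho> l $ i - t)" for t
    unfolding P using prod.permute[OF \<pi>(1), of "\<lambda>i. \<tau> - \<rho> * d $ i - t"] by (simp add: o_def)
  finally show ?thesis unfolding eigenvalue_tuple_def \<tau>_def by blast
qed

end

text \<open>The two choices of an order that are hidden in \<open>eigenvalues\<close> are independent, so only equality up
  to a permutation can be expected.\<close>

lemma eigenvalues_P_map:
  fixes g S S' :: "('m, 'n::finite) tensor2"
  assumes "pencil (g c p) (S c p)"
    and S': "S' c p = trace_g g S c p *\<^sub>R g c p - \<rho> *\<^sub>R S c p"
  obtains \<pi> where "\<pi> permutes UNIV" "eigenvalues g S' c p = P_map \<rho> (\<chi> i. eigenvalues g S c p $ \<pi> i)"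
proof -
  interpret pencil "g c p" "S c p" by fact
  let ?l = "eigenvalues g S c p" and ?l' = "eigenvalues g S' c p"
  have "eigenvalue_tuple (g c p) (S c p) ?l"
    unfolding eigenvalues_def by (rule someI_ex[OF eigenvalue_tuple_exists])
  hence Pl: "eigenvalue_tuple (g c p) (S' c p) (P_map \<rho> ?l)"
    unfolding S' trace_g_def by (rule eigenvalue_tuple_P_map)
  hence "eigenvalue_tuple (g c p) (S' c p) ?l'"
    unfolding eigenvalues_def by (rule someI)
  then obtain \<pi> where \<pi>: "\<pi> permutes UNIV" "?l' = (\<chi> i. P_map \<rho> ?l $ \<pi> i)"
    using eigenvalue_tuple_unique_up_to_permutation[OF Pl] by blast
  have "?l' = P_map \<rho> (\<chi> i. ?l $ \<pi> i)"
    using sum.permute[OF \<pi>(1), of "($) ?l"] by (simp add: \<pi>(2) vec_eq_iff P_map_nth o_def)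
  thus ?thesis using that \<pi>(1) by blast
qed

section \<open>Symmetry of the Hessian\<close>

text \<open>The mean value theorem in direction \<open>a\<close> turns the second difference into \<open>h\<close> times an increment of
  \<open>F' \<cdot> a\<close> over the step \<open>h b\<close>, up to two points at distance \<open>O(h)\<close> from \<open>x\<close>, and there
  differentiability of \<open>F' \<cdot> a\<close> at the single point \<open>x\<close> suffices.  Since the second difference is
  symmetric in \<open>a\<close> and \<open>b\<close>, symmetry of the second derivative follows.\<close>

lemma second_difference_quotient_tendsto:
  fixes F :: "'a::real_normed_vector \<Rightarrow> real"
  assumes U: "open U" "x \<in> U"
    and F: "\<And>y. y \<in> U \<Longrightarrow> (F has_derivative F' y) (at y)"
    and L: "((\<lambda>y. F' y a) has_derivative L) (at x)"
  shows "((\<lambda>h. (F (x + h *\<^sub>R a + h *\<^sub>R b) - F (x + h *\<^sub>R a) - F (x + h *\<^sub>R b) + F x) / h\<^sup>2)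
    \<longlongrightarrow> L b) (at_right 0)"
proof (rule tendstoI)
  fix e :: real assume e: "0 < e"
  \<comment> \<open>The errors at the two points are at most \<open>h (|a| + |b|)\<close> and \<open>h |a|\<close> times \<open>e / M\<close>, so that their
    sum stays below \<open>e h\<close>; the summand \<open>1\<close> makes the estimate strict.\<close>
  define M where "M = 2 * norm a + norm b + 1"
  have M: "0 < M" unfolding M_def by (intro add_nonneg_pos) auto
  have e': "0 < e / M" using e M by simp
  obtain d1 where d1: "0 < d1" "\<And>y. norm (y - x) < d1 \<Longrightarrow>
      norm (F' y a - F' x a - L (y - x)) \<le> e / M * norm (y - x)"
    using L[unfolded has_derivative_at_alt] e' by blast
  obtain d2 where d2: "0 < d2" "ball x d2 \<subseteq> U"
    using U open_contains_ball by blast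
  have lin: "linear L" using L has_derivative_linear by blast
  define d where "d = min d1 d2 / M"
  have d: "0 < d" using d1 d2 M by (simp add: d_def)
  have "dist ((F (x + h *\<^sub>R a + h *\<^sub>R b) - F (x + h *\<^sub>R a) - F (x + h *\<^sub>R b) + F x) / h\<^sup>2) (L b) < e"
    if h: "0 < h" "h < d" for h
  proof -
    have hM: "h * M < min d1 d2" using h M by (simp add: d_def pos_less_divide_eq)
    \<comment> \<open>\<open>r\<close> is \<open>0\<close> on the lower and \<open>h\<close> on the upper side of the parallelogram.\<close>
    have small: "norm (s *\<^sub>R a + r *\<^sub>R b) \<le> h * norm a + r * norm b"
      "norm (s *\<^sub>R a + r *\<^sub>R b) < min d1 d2"
      if "0 \<le> s" "s \<le> h" "0 \<le> r" "r \<le> h" for s r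
    proof -
      have "norm (s *\<^sub>R a + r *\<^sub>R b) \<le> s * norm a + r * norm b"
        using norm_triangle_ineq[of "s *\<^sub>R a" "r *\<^sub>R b"] that by simp
      also have "\<dots> \<le> h * norm a + r * norm b"
        using that by (intro add_mono mult_right_mono) auto
      finally show 1: "norm (s *\<^sub>R a + r *\<^sub>R b) \<le> h * norm a + r * norm b" .
      have "h * norm a + r * norm b \<le> h * norm a + h * norm b"
        using that by (intro add_mono mult_right_mono) auto
      also have "\<dots> \<le> h * M" unfolding M_def using h by (simp add: algebra_simps)
      finally show "norm (s *\<^sub>R a + r *\<^sub>R b) < min d1 d2" using 1 hM by linarith
    qed
    define \<psi> where "\<psi> s = F (x + s *\<^sub>R a + h *\<^sub>R b) - F (x + s *\<^sub>R a)" for s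
    have inU: "x + (s *\<^sub>R a + r *\<^sub>R b) \<in> U" if "0 \<le> s" "s \<le> h" "0 \<le> r" "r \<le> h" for s r
    proof -
      have "x + (s *\<^sub>R a + r *\<^sub>R b) \<in> ball x d2"
        using small(2)[OF that] by (metis add_diff_cancel_left' dist_commute dist_norm mem_ball min_less_iff_conj)
      thus ?thesis using d2 by blast
    qed
    have der: "((\<lambda>s. F (x + s *\<^sub>R a + r *\<^sub>R b)) has_real_derivative
        F' (x + s *\<^sub>R a + r *\<^sub>R b) a) (at s)"
      if "0 \<le> s" "s \<le> h" "0 \<le> r" "r \<le> h" for s r
    proof -
      have 1: "(F has_derivative F' (x + s *\<^sub>R a + r *\<^sub>R b)) (at (x + s *\<^sub>R a + r *\<^sub>R b))"
        using F[OF inU[OF that]] by (simp add: add.assoc)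
      have 2: "((\<lambda>s. x + s *\<^sub>R a + r *\<^sub>R b) has_derivative (\<lambda>t. t *\<^sub>R a)) (at s)"
        by (auto intro!: derivative_eq_intros)
      have "((\<lambda>s. F (x + s *\<^sub>R a + r *\<^sub>R b)) has_derivative
          (\<lambda>t. F' (x + s *\<^sub>R a + r *\<^sub>R b) (t *\<^sub>R a))) (at s)"
        using has_derivative_compose[OF 2 1] .
      moreover have "linear (F' (x + s *\<^sub>R a + r *\<^sub>R b))"
        using 1 has_derivative_linear by blast
      ultimately show ?thesis
        by (simp add: has_field_derivative_def linear_cmul mult.commute[of _ "F' _ _"])
    qed
    have "\<exists>\<xi>>0. \<xi> < h \<and> \<psi> h - \<psi> 0 =
        (h - 0) * (F' (x + \<xi> *\<^sub>R a + h *\<^sub>R b) a - F' (x + \<xi> *\<^sub>R a) a)"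
    proof (rule MVT2)
      fix s assume s: "0 \<le> s" "s \<le> h"
      show "(\<psi> has_real_derivative F' (x + s *\<^sub>R a + h *\<^sub>R b) a - F' (x + s *\<^sub>R a) a) (at s)"
        unfolding \<psi>_def using der[of s h] der[of s 0] s h by (auto intro: DERIV_diff)
    qed (use h in auto)
    then obtain \<xi> where xi: "0 < \<xi>" "\<xi> < h"
      and eq: "\<psi> h - \<psi> 0 = h * (F' (x + \<xi> *\<^sub>R a + h *\<^sub>R b) a - F' (x + \<xi> *\<^sub>R a) a)" by auto
    let ?A = "F' (x + (\<xi> *\<^sub>R a + h *\<^sub>R b)) a - F' x a - L (\<xi> *\<^sub>R a + h *\<^sub>R b)"
    let ?B = "F' (x + (\<xi> *\<^sub>R a + 0 *\<^sub>R b)) a - F' x a - L (\<xi> *\<^sub>R a + 0 *\<^sub>R b)"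
    have A: "norm ?A \<le> e / M * (h * norm a + h * norm b)"
    proof -
      have "norm ?A \<le> e / M * norm (\<xi> *\<^sub>R a + h *\<^sub>R b)"
        using d1(2)[of "x + (\<xi> *\<^sub>R a + h *\<^sub>R b)"] small(2)[of \<xi> h] xi by simp
      also have "\<dots> \<le> e / M * (h * norm a + h * norm b)"
        using small(1)[of \<xi> h] xi e' by (intro mult_left_mono) auto
      finally show ?thesis .
    qed
    have B: "norm ?B \<le> e / M * (h * norm a)"
    proof -
      have "norm ?B \<le> e / M * norm (\<xi> *\<^sub>R a + 0 *\<^sub>R b)"
        using d1(2)[of "x + (\<xi> *\<^sub>R a + 0 *\<^sub>R b)"] small(2)[of \<xi> 0] xi by simp
      also have "\<dots> \<le> e / M * (h * norm a)"
        using small(1)[of \<xi> 0] xi e' by (intro mult_left_mono) auto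
      finally show ?thesis .
    qed
    have "\<psi> h - \<psi> 0 = h * (h * L b + (?A - ?B))"
      using eq lin by (simp add: linear_add linear_cmul add.assoc)
    hence "(\<psi> h - \<psi> 0) / h\<^sup>2 = L b + (?A - ?B) / h"
      using h by (simp only: power2_eq_square) (simp add: add_divide_distrib)
    hence "(\<psi> h - \<psi> 0) / h\<^sup>2 - L b = (?A - ?B) / h" by linarith
    hence "\<bar>(\<psi> h - \<psi> 0) / h\<^sup>2 - L b\<bar> = \<bar>?A - ?B\<bar> / h"
      using h by simp
    also have "\<dots> \<le> (e / M * (h * norm a + h * norm b) + e / M * (h * norm a)) / h"
      using A B h by (intro divide_right_mono) auto
    also have "\<dots> = e / M * (M - 1)"
    proof -
      have "h * norm a + h * norm b + h * norm a = (M - 1) * h" by (simp add: M_def algebra_simps)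
      hence "e / M * (h * norm a + h * norm b) + e / M * (h * norm a) = e / M * ((M - 1) * h)"
        by (simp only: distrib_left[symmetric])
      thus ?thesis using h by simp
    qed
    also have "\<dots> < e / M * M" using e' by (intro mult_strict_left_mono) auto
    also have "\<dots> = e" using M by simp
    finally show ?thesis by (simp add: dist_real_def \<psi>_def algebra_simps)
  qed
  thus "\<forall>\<^sub>F h in at_right 0. dist ((F (x + h *\<^sub>R a + h *\<^sub>R b) - F (x + h *\<^sub>R a)
      - F (x + h *\<^sub>R b) + F x) / h\<^sup>2) (L b) < e"
    using d by (auto simp: eventually_at_right_field)
qed

lemma symmetric_second_derivative:
  fixes F :: "'a::real_normed_vector \<Rightarrow> real"
  assumes "open U" "x \<in> U"
    and "\<And>y. y \<in> U \<Longrightarrow> (F has_derivative F' y) (at y)"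
    and "((\<lambda>y. F' y a) has_derivative L) (at x)"
    and "((\<lambda>y. F' y b) has_derivative M) (at x)"
  shows "L b = M a"
proof (rule tendsto_unique)
  show "((\<lambda>h. (F (x + h *\<^sub>R a + h *\<^sub>R b) - F (x + h *\<^sub>R a) - F (x + h *\<^sub>R b) + F x) / h\<^sup>2)
    \<longlongrightarrow> L b) (at_right 0)"
    by (rule second_difference_quotient_tendsto[OF assms(1-4)])
  show "((\<lambda>h. (F (x + h *\<^sub>R a + h *\<^sub>R b) - F (x + h *\<^sub>R a) - F (x + h *\<^sub>R b) + F x) / h\<^sup>2)
    \<longlongrightarrow> M a) (at_right 0)"
    using second_difference_quotient_tendsto[OF assms(1-3,5), of a]
    by (simp add: algebra_simps)
qed simp

text \<open>At a boundary point, each coordinate direction still enters the half space in the positive sense,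
  and this determines a derivative.\<close>

lemma has_derivative_unique_half_space:
  fixes F :: "real^'n::{finite,linorder} \<Rightarrow> real"
  assumes S: "openin (top_of_set half_space) S" and y: "y \<in> S"
    and A: "(F has_derivative A) (at y within S)" and B: "(F has_derivative B) (at y within S)"
  shows "A = B"
proof (rule frechet_derivative_unique_within[OF A B])
  fix i :: "real^'n::{finite,linorder}" and e :: real assume i: "i \<in> Basis" and e: "0 < e"
  obtain T where T: "open T" "S = half_space \<inter> T" using S openin_open by blast
  then obtain r where r: "0 < r" "ball y r \<subseteq> T" using y open_contains_ball by blast
  define d where "d = min e r / 2"
  have d: "0 < d" "d < e" "d < r" using e r by (auto simp: d_def)
  obtain k where k: "i = axis k 1" using i by (auto simp: Basis_vec_def)
  have "y + d *\<^sub>R i \<in> half_space"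
    using y T d by (auto simp: half_space_def k axis_def)
  moreover have "y + d *\<^sub>R i \<in> T"
    using r d i by (auto simp: dist_norm subset_iff)
  ultimately show "\<exists>d. 0 < \<bar>d\<bar> \<and> \<bar>d\<bar> < e \<and> y + d *\<^sub>R i \<in> S"
    using T d by (intro exI[of _ d]) auto
qed

text \<open>The one-sided derivative in a chart is that of any differentiable extension of the function in
  coordinates.\<close>

lemma cpartial_eq_extension:
  fixes c :: "('m, 'n::{finite,linorder}) chart"
  assumes S: "openin (top_of_set half_space) (snd c ` dom_of c)" and p: "p \<in> dom_of c"
    and U: "open U" "snd c p \<in> U"
    and E: "\<And>y. y \<in> snd c ` dom_of c \<inter> U \<Longrightarrow> E y = F (coord_inv c y)"
    and D: "(E has_derivative E') (at (snd c p))"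
  shows "cpartial c i F p = E' (axis i 1)"
proof -
  let ?S = "snd c ` dom_of c"
  have "(F \<circ> coord_inv c has_derivative E') (at (snd c p) within ?S)"
  proof -
    obtain r where r: "0 < r" "ball (snd c p) r \<subseteq> U" using U open_contains_ball by blast
    show ?thesis
    proof (rule has_derivative_transform_within[OF has_derivative_at_withinI[OF D] r(1)])
      show "snd c p \<in> ?S" using p by simp
      fix y assume "y \<in> ?S" "dist y (snd c p) < r"
      thus "E y = (F \<circ> coord_inv c) y"
        using r E by (auto simp: subset_iff dist_commute)
    qed
  qed
  moreover from this have "(F \<circ> coord_inv c has_derivative
      frechet_derivative (F \<circ> coord_inv c) (at (snd c p) within ?S)) (at (snd c p) within ?S)"
    using differentiable_def frechet_derivative_works by blast
  ultimately have "frechet_derivative (F \<circ> coord_inv c) (at (snd c p) within ?S) = E'"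
    using has_derivative_unique_half_space[OF S] p by blast
  thus ?thesis by (simp add: cpartial_def)
qed

text \<open>Near the point, the first coordinate derivatives are extended by those of a \<open>C\<^sup>2\<close> extension \<open>E\<close> of
  \<open>u\<close>, so the second ones agree with those of \<open>E\<close>, which commute.\<close>

lemma second_cpartial_commute:
  fixes c :: "('m, 'n::{finite,linorder}) chart"
  assumes S: "openin (top_of_set half_space) (snd c ` dom_of c)" and p: "p \<in> dom_of c"
    and u: "Ck_on 2 (snd c ` dom_of c) (u \<circ> coord_inv c)"
  shows "cpartial c i (cpartial c j u) p = cpartial c j (cpartial c i u) p"
proof -
  let ?S = "snd c ` dom_of c" and ?x = "snd c p"
  have "?x \<in> ?S" using p by simp
  with u obtain U E where U: "open U" "?x \<in> U" and Ck: "\<And>j. enat j \<le> 2 \<Longrightarrow> Ck_open j U E"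
    and E: "\<And>y. y \<in> ?S \<inter> U \<Longrightarrow> E y = (u \<circ> coord_inv c) y"
    unfolding Ck_on_def by metis
  define E' where "E' y = frechet_derivative E (at y)" for y
  have "enat (Suc (Suc 0)) \<le> 2" by (simp add: numeral_eq_enat)
  from Ck[OF this] have diff: "\<And>y. y \<in> U \<Longrightarrow> E differentiable (at y)"
    and diff2: "\<And>k y. y \<in> U \<Longrightarrow> (\<lambda>y. E' y (axis k 1)) differentiable (at y)"
    by (auto simp: E'_def)
  have E': "(E has_derivative E' y) (at y)" if "y \<in> U" for y
    using diff[OF that] unfolding E'_def by (simp add: frechet_derivative_works)
  define H where "H k = frechet_derivative (\<lambda>y. E' y (axis k 1)) (at ?x)" for k
  have H: "((\<lambda>y. E' y (axis k 1)) has_derivative H k) (at ?x)" for k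
    using diff2[OF U(2)] unfolding H_def by (simp add: frechet_derivative_works)
  have first: "cpartial c k u (coord_inv c y) = E' y (axis k 1)" if "y \<in> ?S \<inter> U" for k y
    using that by (intro cpartial_eq_extension[OF S _ U(1), where E = E])
      (auto simp: f_inv_into_f inv_into_into E E')
  have "cpartial c i (cpartial c j u) p = H j (axis i 1)" for i j
    by (rule cpartial_eq_extension[OF S p U, where E = "\<lambda>y. E' y (axis j 1)"])
      (auto simp: first H)
  moreover have "H j (axis i 1) = H i (axis j 1)"
    by (rule symmetric_second_derivative[OF U E' H H])
  ultimately show ?thesis by simp
qed

lemma cpartial_cong:
  assumes "p \<in> dom_of c" and "\<And>q. q \<in> dom_of c \<Longrightarrow> F q = F' q"
  shows "cpartial c i F p = cpartial c i F' p"
proof -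
  let ?S = "snd c ` dom_of c"
  have eq: "(F \<circ> coord_inv c) y = (F' \<circ> coord_inv c) y" if "y \<in> ?S" for y
    using that assms(2) by (simp add: inv_into_into)
  have p: "snd c p \<in> ?S" using assms(1) by simp
  have "(F \<circ> coord_inv c has_derivative D) (at (snd c p) within ?S) \<longleftrightarrow>
      (F' \<circ> coord_inv c has_derivative D) (at (snd c p) within ?S)" for D
  proof
    show "(F \<circ> coord_inv c has_derivative D) (at (snd c p) within ?S)"
      if "(F' \<circ> coord_inv c has_derivative D) (at (snd c p) within ?S)"
      by (rule has_derivative_transform[OF p _ that]) (rule eq)
    show "(F' \<circ> coord_inv c has_derivative D) (at (snd c p) within ?S)"
      if "(F \<circ> coord_inv c has_derivative D) (at (snd c p) within ?S)"
      by (rule has_derivative_transform[OF p _ that]) (rule eq[symmetric])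
  qed
  thus ?thesis unfolding cpartial_def frechet_derivative_def by simp
qed

lemma christoffel_commute:
  assumes "p \<in> dom_of c" and g: "\<And>q. q \<in> dom_of c \<Longrightarrow> transpose (g c q) = g c q"
  shows "christoffel g c k i j p = christoffel g c k j i p"
proof -
  have "g c q $ i $ j = g c q $ j $ i" if "q \<in> dom_of c" for q
    by (subst g[OF that, symmetric]) (simp add: transpose_def)
  hence "cpartial c l (\<lambda>q. g c q $ i $ j) p = cpartial c l (\<lambda>q. g c q $ j $ i) p" for l
    using assms(1) by (intro cpartial_cong)
  thus ?thesis by (simp add: christoffel_def add.commute)
qed

lemma transpose_hessian:
  fixes c :: "('m, 'n::{finite,linorder}) chart"
  assumes "openin (top_of_set half_space) (snd c ` dom_of c)" and "p \<in> dom_of c"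
    and "\<And>q. q \<in> dom_of c \<Longrightarrow> transpose (g c q) = g c q"
    and "Ck_on 2 (snd c ` dom_of c) (u \<circ> coord_inv c)"
  shows "transpose (hessian g u c p) = hessian g u c p"
proof -
  have "cpartial c i (cpartial c j u) p = cpartial c j (cpartial c i u) p" for i j
    by (rule second_cpartial_commute[OF assms(1,2,4)])
  moreover have "christoffel g c k i j p = christoffel g c k j i p" for k i j
    by (rule christoffel_commute[where g = g, OF assms(2,3)])
  ultimately show ?thesis
    by (simp add: vec_eq_iff transpose_def hessian_def)
qed

section \<open>The proposition\<close>

lemma transpose_add: "transpose (A + B) = transpose A + transpose (B :: real^'n^'m)"
  by (simp add: transpose_def vec_eq_iff)

lemma pencil_hessian:
  fixes c :: "('m, 'n::{finite,linorder}) chart"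
  assumes X: "smooth_manifold_with_boundary X \<A>" and g: "riemannian_metric \<A> g"
    and chi: "symmetric_tensor \<A> chi" and u: "Ck_function 2 \<A> u"
    and c: "c \<in> \<A>" "p \<in> dom_of c"
  shows "pencil (g c p) (hessian g u c p + chi c p)"
proof
  have g_sym: "transpose (g c q) = g c q" if "q \<in> dom_of c" for q
    using g c that unfolding riemannian_metric_def symmetric_tensor_def by blast
  show "transpose (g c p) = g c p" by (rule g_sym[OF c(2)])
  have "openin (top_of_set half_space) (snd c ` dom_of c)"
    using X c by (auto simp: smooth_manifold_with_boundary_def is_chart_def)
  moreover have "Ck_on 2 (snd c ` dom_of c) (u \<circ> coord_inv c)"
    using u c by (simp add: Ck_function_def)
  ultimately have "transpose (hessian g u c p) = hessian g u c p"
    using transpose_hessian[where g = g, OF _ c(2) g_sym] by blast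
  thus "transpose (hessian g u c p + chi c p) = hessian g u c p + chi c p"
    using chi c unfolding transpose_add symmetric_tensor_def by metis
  show "0 < v \<bullet> (g c p *v v)" if "v \<noteq> 0" for v
    using g c that unfolding riemannian_metric_def by blast
qed

lemma trace_modified_hessian:
  assumes chi': "chi' = (\<lambda>c p. trace_g g chi c p *\<^sub>R g c p - \<rho> *\<^sub>R chi c p)"
  shows "laplacian g u c p *\<^sub>R g c p - \<rho> *\<^sub>R hessian g u c p + chi' c p =
    trace_g g (\<lambda>c p. hessian g u c p + chi c p) c p *\<^sub>R g c p - \<rho> *\<^sub>R (hessian g u c p + chi c p)"
  by (simp add: chi' laplacian_def trace_g_def matrix_add_ldistrib trace_add algebra_simps)

theorem proposition2p6:
  fixes X :: "'m topology"
    and \<A> :: "('m, 'n::{finite,linorder}) chart set"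
    and g :: "('m, 'n) tensor2"
    and f f' :: "real^'n::{finite,linorder} \<Rightarrow> real"
    and \<Gamma> \<Gamma>' :: "(real^'n::{finite,linorder}) set"
    and \<rho> :: real
  assumes "smooth_manifold_with_boundary X \<A>"
    and "compact_space X" and "connected_space X"
    and "riemannian_metric \<A> g"
    and "2 \<le> CARD('n)"
    and "admissible_pair f \<Gamma>"
    and "concave_on \<Gamma> f"
    and "\<forall>l\<in>\<Gamma>. \<forall>i. 0 < frechet_derivative f (at l) (axis i 1)"
    and "0 < \<rho>" and "real CARD('n) - rho_G f \<Gamma> \<le> \<rho>" and "\<rho> < real CARD('n)"
    and "\<Gamma>' = P_map \<rho> ` \<Gamma>"
    and "\<forall>l\<in>\<Gamma>. f' (P_map \<rho> l) = f l"
  shows "\<rho> \<le> rho_G f' \<Gamma>' \<and>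
    (\<forall>chi chi' u.
       symmetric_tensor \<A> chi \<longrightarrow>
       chi' = (\<lambda>c p. trace_g g chi c p *\<^sub>R g c p - \<rho> *\<^sub>R chi c p) \<longrightarrow>
       Ck_function 2 \<A> u \<longrightarrow>
       (\<forall>c\<in>\<A>. \<forall>p\<in>dom_of c. eigenvalues g (\<lambda>c p. hessian g u c p + chi c p) c p \<in> \<Gamma>) \<longrightarrow>
       (\<forall>c\<in>\<A>. \<forall>p\<in>dom_of c.
          eigenvalues g
            (\<lambda>c p. laplacian g u c p *\<^sub>R g c p - \<rho> *\<^sub>R hessian g u c p + chi' c p) c p \<in> \<Gamma>' \<and>
          f (eigenvalues g (\<lambda>c p. hessian g u c p + chi c p) c p) =
          f' (eigenvalues g
            (\<lambda>c p. laplacian g u c p *\<^sub>R g c p - \<rho> *\<^sub>R hessian g u c p + chi' c p) c p))) \<and>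
    (axis (Max UNIV) 1 \<in> interior (cone_G f \<Gamma>) \<longleftrightarrow> \<rho> < rho_G f' \<Gamma>')"
proof (intro conjI allI impI ballI)
  note X = assms(1) and g = assms(4) and pair = assms(6) and \<Gamma>' = assms(12)
  have mono: "\<And>l i. l \<in> \<Gamma> \<Longrightarrow> 0 < frechet_derivative f (at l) (axis i 1)" using assms(8) by blast
  have f': "\<And>l. l \<in> \<Gamma> \<Longrightarrow> f' (P_map \<rho> l) = f l" using assms(13) by blast
  note cones = rho_G_P_map_image[OF pair assms(7) mono assms(9-11) f']
  show "\<rho> \<le> rho_G f' \<Gamma>'" using cones(1) by (simp add: \<Gamma>')
  show "axis (Max UNIV) 1 \<in> interior (cone_G f \<Gamma>) \<longleftrightarrow> \<rho> < rho_G f' \<Gamma>'"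
    using cones(2) by (simp add: \<Gamma>')
  fix chi chi' u c p
  assume chi: "symmetric_tensor \<A> chi"
    and chi': "chi' = (\<lambda>c p. trace_g g chi c p *\<^sub>R g c p - \<rho> *\<^sub>R chi c p)"
    and u: "Ck_function 2 \<A> u"
    and dom: "\<forall>c\<in>\<A>. \<forall>p\<in>dom_of c. eigenvalues g (\<lambda>c p. hessian g u c p + chi c p) c p \<in> \<Gamma>"
    and c: "c \<in> \<A>" "p \<in> dom_of c"
  let ?S = "\<lambda>c p. hessian g u c p + chi c p"
  let ?S' = "\<lambda>c p. laplacian g u c p *\<^sub>R g c p - \<rho> *\<^sub>R hessian g u c p + chi' c p"
  let ?l = "eigenvalues g ?S c p" and ?l' = "eigenvalues g ?S' c p"
  have pen: "pencil (g c p) (?S c p)" by (rule pencil_hessian[OF X g chi u c])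
  obtain \<pi> where \<pi>: "\<pi> permutes UNIV" "?l' = P_map \<rho> (\<chi> i. ?l $ \<pi> i)"
    using eigenvalues_P_map[where g = g and S = ?S and S' = ?S', OF pen
        trace_modified_hessian[OF chi']] .
  have l: "?l \<in> \<Gamma>" using dom c by blast
  hence \<pi>l: "(\<chi> i. ?l $ \<pi> i) \<in> \<Gamma>"
    using pair \<pi>(1) by (auto simp: admissible_pair_def admissible_cone_def)
  show "?l' \<in> \<Gamma>'" unfolding \<pi>(2) \<Gamma>' using \<pi>l by (rule imageI)
  have "f' ?l' = f (\<chi> i. ?l $ \<pi> i)" unfolding \<pi>(2) by (rule f'[OF \<pi>l])
  also have "\<dots> = f ?l" using pair \<pi>(1) l by (auto simp: admissible_pair_def)
  finally show "f ?l = f' ?l'" by (rule sym)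
qed

end
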